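(* Let $n\ge 0$ and let $p,q$ be distinct primes with $p,q>3$. For $G=C_{pq^n}$, every saturated $G$-transfer system is linear isometric.
   Context: $C_k$ denotes the cyclic group of order $k$, $\mathrm{Sub}(G)$ the lattice of subgroups of a finite group $G$, and $\mathfrak S_r$ the symmetric group on $r$ letters. Transfer systems. For an Abelian finite group $G$, a $G$-transfer system is a relation $\to$ on $\mathrm{Sub}(G)$ refining inclusion ($K\to H$ implies $K\le H$) such that: $H\to H$ for all $H\le G$; $L\to K$ and $K\to H$ imply $L\to H$; $K\to H$ and $M\le H$ imply $K\cap M\to M$. (For general $G$ one also requires closure under conjugation, automatic for Abelian $G$.) It is saturated if whenever $L\le K\le H\le G$ and two of the three relations $L\to K$, $L\to H$, $K\to H$ hold, then so does the third. Linear isometries operads. A $G$-universe $U$ is a countably infinite-dimensional real inner product space with a $G$-action by linear isometries that contains each of its finite-dimensional subrepresentations infinitely often and contains the trivial representation. The linear isometries operad $\mathcal L(U)$ is given at level $r$ by the $G\times\mathfrak S_r$-space $\mathcal L(U^r,U)$ of all (not necessarily equivariant) linear isometries $U^r\to U$ (not required to be surjective), with $G$ acting by conjugation and $\mathfrak S_r$ acting by permuting inputs; operadic composition is composition of isometries. Transfer system of an operad. For $\mathscr O=\mathcal L(U)$, define $K\to_{\mathscr O}H$ if and only if $K\le H$ and $\mathscr O([H:K])^{\Gamma(H/K)}\neq\varnothing$, where $\Gamma(H/K)=\{(h,\sigma(h)) : h\in H\}\le G\times\mathfrak S_{[H:K]}$ is the graph of a permutation representation $\sigma\colon H\to\mathfrak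 S_{[H:K]}$ of the $H$-set $H/K$. This relation is a (saturated) $G$-transfer system. A $G$-transfer system is linear isometric if it equals $\to_{\mathcal L(U)}$ for some $G$-universe $U$. *)

theory Defs
  imports
    "HOL-Analysis.Analysis"
    "HOL-Library.Poly_Mapping"
    "HOL-Algebra.Elementary_Groups"
    "HOL-Algebra.Group_Action"
    "HOL-Algebra.Left_Coset"
    "HOL-Algebra.Sym_Groups"
begin

section \<open>Transfer systems\<close>

text \<open>
  Conjugation closure is omitted because it is automatic for abelian groups, which are the only
  ones considered. A relation is required to hold only between subgroups of \<open>G\<close>, so two
  transfer systems agree on the subgroup lattice iff they are equal as predicates.
\<close>

locale transfer_system = comm_group G
  for G :: "('a, 'b) monoid_scheme" (structure) and R :: "'a set \<Rightarrow> 'a set \<Rightarrow> bool" +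
  assumes finite_carrier: "finite (carrier G)"
    and subgroups: "R K H \<Longrightarrow> subgroup K G \<and> subgroup H G"
    and refines_inclusion: "R K H \<Longrightarrow> K \<subseteq> H"
    and reflexive: "subgroup H G \<Longrightarrow> R H H"
    and transitive: "R L K \<Longrightarrow> R K H \<Longrightarrow> R L H"
    and restriction: "R K H \<Longrightarrow> subgroup M G \<Longrightarrow> M \<subseteq> H \<Longrightarrow> R (K \<inter> M) M"

locale saturated_transfer_system = transfer_system +
  assumes two_out_of_three:
    "\<lbrakk>subgroup L G; subgroup K G; subgroup H G; L \<subseteq> K; K \<subseteq> H\<rbrakk> \<Longrightarrow>
      (R L K \<and> R L H \<longrightarrow> R K H) \<and> (R L K \<and> R K H \<longrightarrow> R L H) \<and> (R L H \<and> R K H \<longrightarrow> R L K)"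


section \<open>Universes\<close>

definition subrepresentation ::
  "('a, 'b) monoid_scheme \<Rightarrow> ('a \<Rightarrow> 'u \<Rightarrow> 'u) \<Rightarrow> 'u::real_vector set \<Rightarrow> bool"
  where "subrepresentation G \<rho> V \<longleftrightarrow> subspace V \<and> (\<forall>g\<in>carrier G. \<forall>v\<in>V. \<rho> g v \<in> V)"

definition finite_dimensional :: "'u::real_vector set \<Rightarrow> bool"
  where "finite_dimensional V \<longleftrightarrow> (\<exists>B. finite B \<and> span B = V)"

text \<open>
  The isomorphism is given by the restriction to \<open>V\<close> of a linear map on the whole space; every
  linear map on a subspace extends.
\<close>

definition isomorphic_subrepresentations ::
  "('a, 'b) monoid_scheme \<Rightarrow> ('a \<Rightarrow> 'u \<Rightarrow> 'u) \<Rightarrow> 'u::real_inner set \<Rightarrow> 'u set \<Rightarrow> bool"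
  where "isomorphic_subrepresentations G \<rho> V W \<longleftrightarrow>
    (\<exists>\<phi>. linear \<phi> \<and> \<phi> ` V = W \<and> (\<forall>v\<in>V. norm (\<phi> v) = norm v) \<and>
         (\<forall>g\<in>carrier G. \<forall>v\<in>V. \<phi> (\<rho> g v) = \<rho> g (\<phi> v)))"

text \<open>The orthogonal direct sum of countably many copies of \<open>V\<close> sits inside the representation.\<close>

definition contains_infinitely_often ::
  "('a, 'b) monoid_scheme \<Rightarrow> ('a \<Rightarrow> 'u \<Rightarrow> 'u) \<Rightarrow> 'u::real_inner set \<Rightarrow> bool"
  where "contains_infinitely_often G \<rho> V \<longleftrightarrow>
    (\<exists>W :: nat \<Rightarrow> 'u set.
       (\<forall>k. subrepresentation G \<rho> (W k) \<and> isomorphic_subrepresentations G \<rho> V (W k)) \<and>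
       (\<forall>j k. j \<noteq> k \<longrightarrow> (\<forall>x\<in>W j. \<forall>y\<in>W k. orthogonal x y)))"

definition G_universe ::
  "('a, 'b) monoid_scheme \<Rightarrow> ('a \<Rightarrow> 'u \<Rightarrow> 'u::real_inner) \<Rightarrow> bool"
  where "G_universe G \<rho> \<longleftrightarrow>
    (\<exists>B :: 'u set. countable B \<and> infinite B \<and> independent B \<and> span B = UNIV) \<and>
    group_action G UNIV \<rho> \<and>
    (\<forall>g\<in>carrier G. orthogonal_transformation (\<rho> g)) \<and>
    (\<forall>V. subrepresentation G \<rho> V \<and> finite_dimensional V \<longrightarrow> contains_infinitely_often G \<rho> V) \<and>
    (\<exists>V. subrepresentation G \<rho> V \<and> dim V = 1 \<and> (\<forall>g\<in>carrier G. \<forall>v\<in>V. \<rho> g v = v))"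


section \<open>The linear isometries operad\<close>

text \<open>\<open>U\<^sup>r\<close>, as families indexed by \<open>{1..r}\<close> and extended by zero to all of \<open>nat\<close>.\<close>

definition direct_power :: "nat \<Rightarrow> (nat \<Rightarrow> 'u::real_vector) set"
  where "direct_power r = {x. \<forall>i. i \<notin> {1..r} \<longrightarrow> x i = 0}"

definition linear_isometries :: "nat \<Rightarrow> ((nat \<Rightarrow> 'u) \<Rightarrow> 'u::real_inner) set"
  where "linear_isometries r =
    {f \<in> extensional (direct_power r).
       (\<forall>x\<in>direct_power r. \<forall>y\<in>direct_power r. f (\<lambda>i. x i + y i) = f x + f y) \<and>
       (\<forall>x\<in>direct_power r. \<forall>c. f (\<lambda>i. c *\<^sub>R x i) = c *\<^sub>R f x) \<and>
       (\<forall>x\<in>direct_power r. \<forall>y\<in>direct_power r.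
          inner (f x) (f y) = (\<Sum>i = 1..r. inner (x i) (y i)))}"

text \<open>
  The left action of \<open>G \<times> \<SS>\<^sub>r\<close> on level \<open>r\<close>:
  \<open>((g, \<tau>) f) (x\<^sub>1, \<dots>, x\<^sub>r) = g f(g\<inverse> x\<^bsub>\<tau> 1\<^esub>, \<dots>, g\<inverse> x\<^bsub>\<tau> r\<^esub>)\<close>.
\<close>

definition isometry_action ::
  "('a, 'b) monoid_scheme \<Rightarrow> ('a \<Rightarrow> 'u \<Rightarrow> 'u) \<Rightarrow> nat \<Rightarrow> 'a \<times> (nat \<Rightarrow> nat) \<Rightarrow>
    ((nat \<Rightarrow> 'u) \<Rightarrow> 'u::real_inner) \<Rightarrow> (nat \<Rightarrow> 'u) \<Rightarrow> 'u"
  where "isometry_action G \<rho> r = (\<lambda>(g, \<tau>) f.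
    \<lambda>x\<in>direct_power r. \<rho> g (f (\<lambda>i. \<rho> (inv\<^bsub>G\<^esub> g) (x (\<tau> i)))))"

definition isometry_fixed_points ::
  "('a, 'b) monoid_scheme \<Rightarrow> ('a \<Rightarrow> 'u \<Rightarrow> 'u) \<Rightarrow> nat \<Rightarrow> ('a \<times> (nat \<Rightarrow> nat)) set \<Rightarrow>
    ((nat \<Rightarrow> 'u) \<Rightarrow> 'u::real_inner) set"
  where "isometry_fixed_points G \<rho> r \<Gamma> =
    {f \<in> linear_isometries r. \<forall>s\<in>\<Gamma>. isometry_action G \<rho> r s f = f}"


section \<open>The transfer system of a linear isometries operad\<close>

definition left_cosets_in ::
  "('a, 'b) monoid_scheme \<Rightarrow> 'a set \<Rightarrow> 'a set \<Rightarrow> 'a set set"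
  where "left_cosets_in G H K = lcosets\<^bsub>G\<lparr>carrier := H\<rparr>\<^esub> K"

definition subgroup_index :: "('a, 'b) monoid_scheme \<Rightarrow> 'a set \<Rightarrow> 'a set \<Rightarrow> nat"
  where "subgroup_index G H K = card (left_cosets_in G H K)"

text \<open>
  \<open>\<sigma>\<close> is the permutation representation of the \<open>H\<close>-set \<open>H/K\<close> with respect to some enumeration
  \<open>b\<close> of the cosets. Different enumerations give conjugate graph subgroups.
\<close>

definition coset_permutation_rep ::
  "('a, 'b) monoid_scheme \<Rightarrow> 'a set \<Rightarrow> 'a set \<Rightarrow> ('a \<Rightarrow> nat \<Rightarrow> nat) \<Rightarrow> bool"
  where "coset_permutation_rep G H K \<sigma> \<longleftrightarrow>
    \<sigma> \<in> hom (G\<lparr>carrier := H\<rparr>) (sym_group (subgroup_index G H K)) \<and>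
    (\<exists>b. bij_betw b {1..subgroup_index G H K} (left_cosets_in G H K) \<and>
         (\<forall>h\<in>H. \<forall>i\<in>{1..subgroup_index G H K}. b (\<sigma> h i) = h <#\<^bsub>G\<^esub> b i))"

definition graph_subgroup :: "'a set \<Rightarrow> ('a \<Rightarrow> nat \<Rightarrow> nat) \<Rightarrow> ('a \<times> (nat \<Rightarrow> nat)) set"
  where "graph_subgroup H \<sigma> = (\<lambda>h. (h, \<sigma> h)) ` H"

definition isometries_transfer ::
  "('a, 'b) monoid_scheme \<Rightarrow> ('a \<Rightarrow> 'u \<Rightarrow> 'u::real_inner) \<Rightarrow> 'a set \<Rightarrow> 'a set \<Rightarrow> bool"
  where "isometries_transfer G \<rho> K H \<longleftrightarrow>
    subgroup K G \<and> subgroup H G \<and> K \<subseteq> H \<and>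
    (\<exists>\<sigma>. coset_permutation_rep G H K \<sigma> \<and>
         isometry_fixed_points G \<rho> (subgroup_index G H K) (graph_subgroup H \<sigma>) \<noteq> {})"


section \<open>The space of finitely supported sequences\<close>

instantiation poly_mapping :: (type, real_vector) real_vector
begin

definition scaleR_poly_mapping :: "real \<Rightarrow> ('a \<Rightarrow>\<^sub>0 'b) \<Rightarrow> 'a \<Rightarrow>\<^sub>0 'b"
  where "scaleR_poly_mapping c = Poly_Mapping.map ((*\<^sub>R) c)"

lemma lookup_scaleR: "Poly_Mapping.lookup (c *\<^sub>R f) k = c *\<^sub>R Poly_Mapping.lookup f k"
  for f :: "'a \<Rightarrow>\<^sub>0 'b"
  by (simp add: scaleR_poly_mapping_def map.rep_eq when_def)

instance
  by standard (auto intro!: poly_mapping_eqI simp: lookup_scaleR lookup_add algebra_simps)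

end

instantiation poly_mapping :: (type, real_inner) real_inner
begin

definition inner_poly_mapping :: "('a \<Rightarrow>\<^sub>0 'b) \<Rightarrow> ('a \<Rightarrow>\<^sub>0 'b) \<Rightarrow> real"
  where "inner_poly_mapping f g =
    (\<Sum>k\<in>Poly_Mapping.keys f. inner (Poly_Mapping.lookup f k) (Poly_Mapping.lookup g k))"

definition norm_poly_mapping :: "('a \<Rightarrow>\<^sub>0 'b) \<Rightarrow> real"
  where "norm_poly_mapping f = sqrt (inner f f)"

definition dist_poly_mapping :: "('a \<Rightarrow>\<^sub>0 'b) \<Rightarrow> ('a \<Rightarrow>\<^sub>0 'b) \<Rightarrow> real"
  where "dist_poly_mapping f g = norm (f - g)"

definition sgn_poly_mapping :: "('a \<Rightarrow>\<^sub>0 'b) \<Rightarrow> 'a \<Rightarrow>\<^sub>0 'b"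
  where "sgn_poly_mapping f = f /\<^sub>R norm f"

definition uniformity_poly_mapping :: "(('a \<Rightarrow>\<^sub>0 'b) \<times> ('a \<Rightarrow>\<^sub>0 'b)) filter"
  where "uniformity_poly_mapping = (INF e\<in>{0<..}. principal {(f, g). dist f g < e})"

definition open_poly_mapping :: "('a \<Rightarrow>\<^sub>0 'b) set \<Rightarrow> bool"
  where "open_poly_mapping S = (\<forall>f\<in>S. \<forall>\<^sub>F (f', g) in uniformity. f' = f \<longrightarrow> g \<in> S)"

lemma inner_poly_mapping_superset:
  fixes f g :: "'a \<Rightarrow>\<^sub>0 'b"
  assumes "finite A" "Poly_Mapping.keys f \<subseteq> A"
  shows "inner f g = (\<Sum>k\<in>A. inner (Poly_Mapping.lookup f k) (Poly_Mapping.lookup g k))"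
  unfolding inner_poly_mapping_def
  using assms by (intro sum.mono_neutral_left) (auto simp: in_keys_iff)

instance
proof
  fix f g h :: "'a \<Rightarrow>\<^sub>0 'b" and c :: real
  define A where "A = Poly_Mapping.keys f \<union> Poly_Mapping.keys g \<union> Poly_Mapping.keys (f + g) \<union>
    Poly_Mapping.keys (c *\<^sub>R f)"
  have A: "finite A" "Poly_Mapping.keys f \<subseteq> A" "Poly_Mapping.keys g \<subseteq> A"
    "Poly_Mapping.keys (f + g) \<subseteq> A" "Poly_Mapping.keys (c *\<^sub>R f) \<subseteq> A"
    by (auto simp: A_def)
  show "dist f g = norm (f - g)" by (rule dist_poly_mapping_def)
  show "sgn f = f /\<^sub>R norm f" by (rule sgn_poly_mapping_def)
  show "(uniformity :: (('a \<Rightarrow>\<^sub>0 'b) \<times> _) filter) =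
      (INF e\<in>{0<..}. principal {(f, g). dist f g < e})"
    by (rule uniformity_poly_mapping_def)
  show "open S = (\<forall>f\<in>S. \<forall>\<^sub>F (f', g) in uniformity. f' = f \<longrightarrow> g \<in> S)"
    for S :: "('a \<Rightarrow>\<^sub>0 'b) set"
    by (rule open_poly_mapping_def)
  show "inner f g = inner g f"
    by (simp add: inner_poly_mapping_superset[OF A(1,2)] inner_poly_mapping_superset[OF A(1,3)]
        inner_commute)
  show "inner (f + g) h = inner f h + inner g h"
    by (simp add: inner_poly_mapping_superset[OF A(1,2)] inner_poly_mapping_superset[OF A(1,3)]
        inner_poly_mapping_superset[OF A(1,4)] lookup_add inner_add_left sum.distrib)
  show "inner (c *\<^sub>R f) g = c * inner f g"
    by (simp add: inner_poly_mapping_superset[OF A(1,2)] inner_poly_mapping_superset[OF A(1,5)]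
        lookup_scaleR sum_distrib_left)
  show "0 \<le> inner f f"
    unfolding inner_poly_mapping_def by (intro sum_nonneg) auto
  show "inner f f = 0 \<longleftrightarrow> f = 0"
    unfolding inner_poly_mapping_def
    by (subst sum_nonneg_eq_0_iff) (auto simp: in_keys_iff intro!: poly_mapping_eqI)
  show "norm f = sqrt (inner f f)" by (rule norm_poly_mapping_def)
qed

end


section \<open>Linear isometric transfer systems\<close>

text \<open>
  By Gram-Schmidt, every real inner product space of countably infinite dimension is isometric to
  \<open>nat \<Rightarrow>\<^sub>0 real\<close>, so quantifying over the actions on this one space covers all universes up to
  isometric isomorphism.
\<close>

definition linear_isometric ::
  "('a, 'b) monoid_scheme \<Rightarrow> ('a set \<Rightarrow> 'a set \<Rightarrow> bool) \<Rightarrow> bool"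
  where "linear_isometric G R \<longleftrightarrow> transfer_system G R \<and>
    (\<exists>\<rho> :: 'a \<Rightarrow> (nat \<Rightarrow>\<^sub>0 real) \<Rightarrow> (nat \<Rightarrow>\<^sub>0 real).
       G_universe G \<rho> \<and> R = isometries_transfer G \<rho>)"

end

(*
  Let theta embed G in the unit circle. A set X of integers with X = -X and 0 in X gives a universe:
  the sum of infinitely many copies of the characters theta^x, x in X. Comparing the isotypic parts
  of U tensor R[H/K] and U over H shows K -> H in its transfer system iff X + |H|Z is stable under
  adding |K|. Both this relation and a saturated transfer system are determined by their values on
  the covering pairs d | d r (r prime) of divisors of p q^n, and X is built for prescribed covering
  pairs by lifting a subset of Z/p x Z/q^b to Z/p x Z/q^(b+1), one b at a time. The bound p, q > 3
  leaves room for {0, 1, -1} to be a proper subset of Z/p and of Z/q.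
*)
theory Submission
  imports
    Defs
    "HOL-Algebra.Multiplicative_Group"
    "HOL-Number_Theory.Cong"
begin

section \<open>Periodic sets of integers\<close>

text \<open>A transfer \<open>K\<close> to \<open>H\<close> amounts to an
  \<open>H\<close>-equivariant isometric embedding of R[H/K] tensor U into U. Multiplicities never
  obstruct it, because every weight is repeated infinitely often, so only the weights modulo |H|
  count; tensoring with R[H/K] translates them by the multiples of |K|. Over the reals the
  characters x and -x give the same representation, which is why all residue sets below are closed
  under negation. The obstacle is that a single X must behave correctly modulo all divisors at once.
  Each class modulo q^b keeps a lift at the next level, so the reductions of X to lower levels never
  shrink, and a covering pair once settled stays settled. Reduction modulo q^b forgets the
  coordinate in Z/p: \<open>l b\<close> sees only the union of the fibres over Z/p, while
  \<open>u b\<close> tests each fibre. Telling \<open>l b\<close> from \<open>u b\<close> therefore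
  takes a nonempty fibre off 0. This is why the base set is {0, 1, -1} and not {0} when
  \<open>h 0\<close> fails.\<close>

lemma chinese_remainder_int:
  fixes p q :: int
  assumes "coprime p q"
  obtains z where "p dvd z - x" "q dvd z - y"
  using binary_chinese_remainder_int[OF assms, of x y] by (auto simp: cong_iff_dvd_diff)

text \<open>
  \<open>h b\<close>, \<open>l b\<close>, \<open>u b\<close> stand for the covering pairs \<open>q\<^sup>b \<rightarrow> p q\<^sup>b\<close>, \<open>q\<^sup>b \<rightarrow> q\<^bsup>b+1\<^esup>\<close> and
  \<open>p q\<^sup>b \<rightarrow> p q\<^bsup>b+1\<^esup>\<close>.
\<close>

locale saturated_edges =
  fixes p q :: int and h l u :: "nat \<Rightarrow> bool"
  assumes p_gt: "p > 3" and q_gt: "q > 3" and coprime_p_q: "coprime p q"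
    and h_antimono: "h (Suc b) \<Longrightarrow> h b"
    and u_imp_l: "u b \<Longrightarrow> l b"
    and l_imp_u: "h (Suc b) \<Longrightarrow> l b \<Longrightarrow> u b"
    and u_imp_h: "h b \<Longrightarrow> u b \<Longrightarrow> h (Suc b)"
begin

text \<open>Residues modulo \<open>q ^ Suc b\<close> of least absolute value over each class modulo
  \<open>q ^ b\<close>. Balanced representatives, unlike those in [0, q^b), are closed under
  negation; the bound is non-strict, so for even \<open>q ^ b\<close> both halves are kept.\<close>

definition small_lifts :: "nat \<Rightarrow> int set"
  where "small_lifts b = {y. \<exists>z. 2 * \<bar>z\<bar> \<le> q ^ b \<and> q ^ Suc b dvd y - z}"

text \<open>
  \<open>admissible b\<close> is a subset of \<open>\<int>/p \<times> \<int>/q\<^sup>b\<close>. The fibre over \<open>0\<close> in \<open>\<int>/p\<close> dominates all others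
  (\<open>admissible_zero_left\<close>), so adding points only there realises \<open>l b\<close> without \<open>u b\<close>, and adding
  just \<open>(0, \<plusminus>q\<^sup>b)\<close> destroys \<open>h (Suc b)\<close> without creating \<open>l b\<close>.
\<close>

fun admissible :: "nat \<Rightarrow> (int \<times> int) set" where
  "admissible 0 = {(x, y). h 0 \<or> p dvd x \<or> p dvd x - 1 \<or> p dvd x + 1}"
| "admissible (Suc b) = {(x, y) \<in> admissible b.
     u b \<or> y \<in> small_lifts b \<or>
     p dvd x \<and> (l b \<or> \<not> h (Suc b) \<and> (q ^ Suc b dvd y - q ^ b \<or> q ^ Suc b dvd y + q ^ b))}"

lemma admissible_Suc_iff:
  "(x, y) \<in> admissible (Suc b) \<longleftrightarrow> (x, y) \<in> admissible b \<and>
    (u b \<or> y \<in> small_lifts b \<or> p dvd x \<and>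
      (l b \<or> \<not> h (Suc b) \<and> (q ^ Suc b dvd y - q ^ b \<or> q ^ Suc b dvd y + q ^ b)))"
  by simp

lemma q_power_pos: "q ^ b > 0"
  using q_gt by simp

lemma small_lifts_cong:
  assumes "y \<in> small_lifts b" "q ^ Suc b dvd y' - y"
  shows "y' \<in> small_lifts b"
proof -
  obtain z where "2 * \<bar>z\<bar> \<le> q ^ b" "q ^ Suc b dvd y - z"
    using assms by (auto simp: small_lifts_def)
  moreover have "q ^ Suc b dvd (y' - y) + (y - z)"
    using assms(2) calculation(2) by (rule dvd_add)
  ultimately show ?thesis
    unfolding small_lifts_def by auto
qed

lemma small_lifts_uminus:
  assumes "y \<in> small_lifts b"
  shows "- y \<in> small_lifts b"
proof -
  obtain z where z: "2 * \<bar>z\<bar> \<le> q ^ b" "q ^ Suc b dvd y - z"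
    using assms by (auto simp: small_lifts_def)
  have "- y - (- z) = - (y - z)" by simp
  then have "q ^ Suc b dvd - y - (- z)"
    using z(2) by (metis dvd_minus_iff)
  then show ?thesis
    unfolding small_lifts_def using z(1) by (intro CollectI exI[of _ "- z"]) auto
qed

lemma zero_in_small_lifts: "0 \<in> small_lifts b"
  using q_power_pos[of b] by (auto simp: small_lifts_def intro!: exI[of _ 0])

lemma small_lifts_surj:
  obtains y' where "y' \<in> small_lifts b" "q ^ b dvd y' - y"
proof -
  define r where "r = y mod q ^ b"
  define z where "z = (if 2 * r \<le> q ^ b then r else r - q ^ b)"
  have r: "0 \<le> r" "r < q ^ b" "q ^ b dvd r - y"
    using q_power_pos[of b] by (auto simp: r_def mod_eq_dvd_iff[symmetric])
  have "2 * \<bar>z\<bar> \<le> q ^ b"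
    using r by (auto simp: z_def)
  then have "z \<in> small_lifts b"
    by (auto simp: small_lifts_def intro!: exI[of _ z])
  moreover have "q ^ b dvd z - y"
    using r(3) dvd_diff[OF r(3) dvd_refl] by (auto simp: z_def algebra_simps)
  ultimately show ?thesis using that by blast
qed

text \<open>The distance from \<open>k * q ^ b\<close> to a balanced representative is at least half
  of \<open>q ^ b\<close> and less than \<open>4 * q ^ b\<close>, hence below the modulus. The case
  \<open>k = 1\<close> shows that the extra points over 0 are really new, the case
  \<open>k = 2\<close> refutes invariance when \<open>l b\<close> fails.\<close>

lemma multiple_notin_small_lifts:
  assumes "k = 1 \<or> k = 2"
  shows "k * q ^ b \<notin> small_lifts b"
proof
  assume "k * q ^ b \<in> small_lifts b"
  then obtain z where z: "2 * \<bar>z\<bar> \<le> q ^ b" "q ^ Suc b dvd k * q ^ b - z"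
    by (auto simp: small_lifts_def)
  have "4 * q ^ b \<le> q ^ Suc b"
    using q_gt q_power_pos[of b] by (auto intro: mult_right_mono)
  then have "\<bar>k * q ^ b - z\<bar> < q ^ Suc b" "k * q ^ b - z \<noteq> 0"
    using z(1) assms q_power_pos[of b] by (auto simp del: power_Suc)
  with z(2) show False
    using dvd_imp_le_int[of "k * q ^ b - z" "q ^ Suc b"] q_power_pos[of "Suc b"] by auto
qed

lemma not_dvd_small_multiple:
  assumes "0 < k" "k \<le> 3"
  shows "\<not> q ^ Suc b dvd k * q ^ b"
proof
  assume "q ^ Suc b dvd k * q ^ b"
  then have "q dvd k"
    using q_gt by auto
  then show False using zdvd_imp_le[of q k] assms q_gt by simp
qed

lemma admissible_Suc_subset: "admissible (Suc b) \<subseteq> admissible b"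
  by auto

lemma admissible_antimono: "b \<le> c \<Longrightarrow> admissible c \<subseteq> admissible b"
  by (rule lift_Suc_antimono_le[of admissible]) (rule admissible_Suc_subset)

lemma admissible_cong:
  assumes "(x, y) \<in> admissible b" "p dvd x' - x" "q ^ b dvd y' - y"
  shows "(x', y') \<in> admissible b"
  using assms
proof (induction b)
  case 0
  have "p dvd x' - c \<longleftrightarrow> p dvd x - c" for c
    using 0(2) dvd_add_right_iff[of p "x' - x" "x - c"] by simp
  from this[of 0] this[of 1] this[of "-1"] show ?case
    using 0 by simp
next
  case (Suc b)
  have "q ^ b dvd y' - y"
    using Suc.prems(3) by (metis dvd_trans le_imp_power_dvd lessI less_imp_le)
  then have "(x', y') \<in> admissible b"
    using Suc by auto
  moreover have "y' \<in> small_lifts b" if "y \<in> small_lifts b"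
    using small_lifts_cong[OF that Suc.prems(3)] .
  moreover have "p dvd x'" if "p dvd x"
    using that Suc.prems(2) dvd_add[of p "x' - x" x] by simp
  moreover have "q ^ Suc b dvd y' - c" if "q ^ Suc b dvd y - c" for c
    using dvd_add[OF Suc.prems(3) that] by simp
  from this[of "q ^ b"] this[of "- (q ^ b)"]
  have "q ^ Suc b dvd y - q ^ b \<Longrightarrow> q ^ Suc b dvd y' - q ^ b"
    "q ^ Suc b dvd y + q ^ b \<Longrightarrow> q ^ Suc b dvd y' + q ^ b" by auto
  ultimately show ?case
    using Suc.prems(1) unfolding admissible_Suc_iff by blast
qed

lemma admissible_uminus: "(x, y) \<in> admissible b \<Longrightarrow> (- x, - y) \<in> admissible b"
proof (induction b)
  case 0
  moreover have "p dvd - x - 1 \<longleftrightarrow> p dvd x + 1" "p dvd - x + 1 \<longleftrightarrow> p dvd x - 1"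
    using dvd_minus_iff[of p "x + 1"] dvd_minus_iff[of p "x - 1"] by simp_all
  ultimately show ?case by auto
next
  case (Suc b)
  have "q ^ Suc b dvd y + q ^ b \<Longrightarrow> q ^ Suc b dvd - y - q ^ b"
    using dvd_minus_iff[of "q ^ Suc b" "y + q ^ b"] by (simp add: algebra_simps)
  moreover have "q ^ Suc b dvd y - q ^ b \<Longrightarrow> q ^ Suc b dvd - y + q ^ b"
    using dvd_minus_iff[of "q ^ Suc b" "y - q ^ b"] by (simp add: algebra_simps)
  ultimately show ?case
    using Suc small_lifts_uminus[of y b] unfolding admissible_Suc_iff dvd_minus_iff
    by blast
qed

lemma zero_in_admissible: "(0, 0) \<in> admissible b"
  by (induction b) (auto simp: zero_in_small_lifts)

lemma one_in_admissible: "(1, 0) \<in> admissible b"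
  by (induction b) (auto simp: zero_in_small_lifts)

lemma admissible_zero_left: "(x, y) \<in> admissible b \<Longrightarrow> (0, y) \<in> admissible b"
  by (induction b) auto

text \<open>The clause \<open>y \<in> small_lifts b\<close> is granted whatever the edges are, and
  it meets every class modulo \<open>q ^ b\<close>. Thus no class is lost on the way up, and the
  final set reduces exactly onto each earlier level.\<close>

lemma admissible_lift_Suc:
  assumes "(x, y) \<in> admissible b"
  obtains y' where "q ^ b dvd y' - y" "(x, y') \<in> admissible (Suc b)"
proof -
  obtain y' where y': "y' \<in> small_lifts b" "q ^ b dvd y' - y"
    by (rule small_lifts_surj)
  have "(x, y') \<in> admissible b"
    using admissible_cong[OF assms _ y'(2)] by simp
  then show ?thesis
    using that[of y'] y' by simp
qed

lemma admissible_lift: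
  assumes "b \<le> c" "(x, y) \<in> admissible b"
  obtains y' where "q ^ b dvd y' - y" "(x, y') \<in> admissible c"
  using assms
proof (induction arbitrary: thesis rule: dec_induct)
  case base
  then show ?case by (metis diff_self dvd_0_right)
next
  case (step c)
  obtain y' where y': "q ^ b dvd y' - y" "(x, y') \<in> admissible c"
    using step.IH step.prems(2) by blast
  obtain y'' where y'': "q ^ c dvd y'' - y'" "(x, y'') \<in> admissible (Suc c)"
    using admissible_lift_Suc[OF y'(2)] by blast
  have "q ^ b dvd y'' - y'"
    using y''(1) step.hyps(1) by (meson dvd_trans le_imp_power_dvd)
  from dvd_add[OF this y'(1)] show ?case
    using step.prems(1) y''(2) by simp
qed

text \<open>If \<open>h (Suc b)\<close> holds, \<open>l b\<close> forces \<open>u b\<close> and the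
  selection clause does not depend on \<open>x\<close>. If \<open>h b\<close> already fails, lifting
  a witness of the failure gives one at the next level. If the failure is new,
  \<open>u_imp_h\<close> excludes \<open>u b\<close>, and the extra point over 0 is the
  witness.\<close>

lemma admissible_horizontal:
  "h b \<longleftrightarrow> (\<forall>x x' y. (x, y) \<in> admissible b \<longrightarrow> (x', y) \<in> admissible b)"
proof (induction b)
  case 0
  have "\<not> p dvd 2" "\<not> p dvd 1" "\<not> p dvd 3"
    using p_gt by (auto dest: zdvd_imp_le)
  \<comment> \<open>The class 2 is outside {0, 1, -1} because \<open>p\<close> divides none of 2, 1
    and 3.\<close>
  then have "(2, 0) \<notin> admissible 0" if "\<not> h 0"
    using that by simp
  moreover have "(x, y) \<in> admissible 0" if "h 0" for x y
    using that by simp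
  ultimately show ?case
    using zero_in_admissible[of 0] by blast
next
  case (Suc b)
  consider "h (Suc b)" | "\<not> h b" "\<not> h (Suc b)" | "h b" "\<not> h (Suc b)"
    using h_antimono by blast
  then show ?case
  proof cases
    case 1
    then have "h b" "l b \<Longrightarrow> u b"
      using h_antimono l_imp_u by blast+
    then have "(x, y) \<in> admissible (Suc b) \<longleftrightarrow>
        (x, y) \<in> admissible b \<and> (u b \<or> y \<in> small_lifts b)" for x y
      using 1 u_imp_l by auto
    with 1 \<open>h b\<close> Suc show ?thesis by blast
  next
    case 2
    then obtain x x' y where xy: "(x, y) \<in> admissible b" "(x', y) \<notin> admissible b"
      using Suc by blast
    obtain y' where y': "q ^ b dvd y' - y" "(x, y') \<in> admissible (Suc b)"
      using admissible_lift_Suc[OF xy(1)] by blast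
    have "(x', y') \<notin> admissible b"
      using xy(2) y'(1) admissible_cong[of x' y' b x' y]
      by (auto simp: dvd_diff_commute)
    then show ?thesis
      using 2 y'(2) admissible_Suc_subset by blast
  next
    case 3
    have "(0, q ^ b) \<in> admissible b"
      using admissible_cong[OF zero_in_admissible[of b], of 0 "q ^ b"] by simp
    then have "(0, q ^ b) \<in> admissible (Suc b)"
      using 3 by simp
    moreover have "(1, q ^ b) \<notin> admissible (Suc b)"
      using 3 u_imp_h[of b] multiple_notin_small_lifts[of 1 b] p_gt by auto
    ultimately show ?thesis
      using 3 by blast
  qed
qed

lemma admissible_exists_diagonal:
  assumes "(x, y) \<in> admissible b"
  obtains z where "(z, z) \<in> admissible b" "p dvd z - x" "q ^ b dvd z - y"
proof -
  have "coprime p (q ^ b)"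
    using coprime_p_q by simp
  then obtain z where z: "p dvd z - x" "q ^ b dvd z - y"
    by (rule chinese_remainder_int)
  with admissible_cong[OF assms z] that show ?thesis by blast
qed

text \<open>The preimage of \<open>admissible n\<close> under the diagonal map from the integers to
  Z/p x Z/q^n, which is onto by the Chinese remainder theorem.\<close>

definition exponents :: "nat \<Rightarrow> int set"
  where "exponents n = {z. (z, z) \<in> admissible n}"

text \<open>Reduction modulo \<open>p * q ^ b\<close> lands in level \<open>b\<close> since the
  levels decrease, and is onto it because every point lifts up to level \<open>n\<close>.\<close>

lemma residues_exponents_pq:
  assumes "b \<le> n"
  shows "(\<exists>x\<in>exponents n. p * q ^ b dvd z - x) \<longleftrightarrow> (z, z) \<in> admissible b"
proof
  assume "\<exists>x\<in>exponents n. p * q ^ b dvd z - x"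
  then obtain x where "(x, x) \<in> admissible n" "p * q ^ b dvd z - x"
    by (auto simp: exponents_def)
  then show "(z, z) \<in> admissible b"
    using admissible_cong[of x x b z z] admissible_antimono[OF assms]
    by (auto dest: dvd_mult_left dvd_mult_right)
next
  assume "(z, z) \<in> admissible b"
  then obtain y where y: "q ^ b dvd y - z" "(z, y) \<in> admissible n"
    using admissible_lift[OF assms] by blast
  obtain w where w: "(w, w) \<in> admissible n" "p dvd w - z" "q ^ n dvd w - y"
    using admissible_exists_diagonal[OF y(2)] by blast
  have "q ^ b dvd w - y"
    using w(3) assms by (meson dvd_trans le_imp_power_dvd)
  from dvd_add[OF this y(1)] have "q ^ b dvd z - w"
    by (simp add: dvd_diff_commute)
  moreover have "p dvd z - w"
    using w(2) by (simp add: dvd_diff_commute)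
  ultimately have "p * q ^ b dvd z - w"
    using coprime_p_q by (simp add: divides_mult)
  then show "\<exists>x\<in>exponents n. p * q ^ b dvd z - x"
    using w(1) by (auto simp: exponents_def)
qed

text \<open>Modulo \<open>q ^ b\<close> the fibres over Z/p are merged. The fibre over 0 contains
  all others by \<open>admissible_zero_left\<close>, so their union is that single fibre.\<close>

lemma residues_exponents_q:
  assumes "b \<le> n"
  shows "(\<exists>x\<in>exponents n. q ^ b dvd z - x) \<longleftrightarrow> (0, z) \<in> admissible b"
proof
  assume "\<exists>x\<in>exponents n. q ^ b dvd z - x"
  then obtain x where x: "(x, x) \<in> admissible n" "q ^ b dvd z - x"
    by (auto simp: exponents_def)
  then have "(0, x) \<in> admissible b"
    using admissible_antimono[OF assms] admissible_zero_left by blast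
  then show "(0, z) \<in> admissible b"
    using admissible_cong[of 0 x b 0 z] x(2) by simp
next
  assume "(0, z) \<in> admissible b"
  then obtain y where y: "q ^ b dvd y - z" "(0, y) \<in> admissible n"
    using admissible_lift[OF assms] by blast
  obtain w where w: "(w, w) \<in> admissible n" "p dvd w - 0" "q ^ n dvd w - y"
    using admissible_exists_diagonal[OF y(2)] by blast
  have "q ^ b dvd w - y"
    using w(3) assms by (meson dvd_trans le_imp_power_dvd)
  from dvd_add[OF this y(1)] have "q ^ b dvd z - w"
    by (simp add: dvd_diff_commute)
  then show "\<exists>x\<in>exponents n. q ^ b dvd z - x"
    using w(1) by (auto simp: exponents_def)
qed

end

section \<open>Translation invariance of a set of integers modulo a divisor\<close>

definition invariant_mod :: "int set \<Rightarrow> int \<Rightarrow> int \<Rightarrow> bool"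
  where "invariant_mod X d e \<longleftrightarrow> (\<forall>z x. x \<in> X \<longrightarrow> e dvd z - x \<longrightarrow> (\<exists>y\<in>X. e dvd z + d - y))"

lemma invariant_mod_iff:
  "invariant_mod X d e \<longleftrightarrow>
    (\<forall>z. (\<exists>x\<in>X. e dvd z - x) \<longrightarrow> (\<exists>x\<in>X. e dvd z + d - x))"
  unfolding invariant_mod_def by blast

lemma invariant_mod_refl: "invariant_mod X d d"
  unfolding invariant_mod_iff
proof clarify
  fix z x assume "x \<in> X" "d dvd z - x"
  then show "\<exists>x\<in>X. d dvd z + d - x"
    using dvd_add[of d "z - x" d] by (auto intro!: bexI[of _ x] simp: algebra_simps)
qed

lemma invariant_mod_mult:
  assumes "invariant_mod X d e" "x \<in> X" "e dvd z - x"
  shows "\<exists>y\<in>X. e dvd z + int k * d - y"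
proof (induction k)
  case 0
  then show ?case using assms by auto
next
  case (Suc k)
  then have "\<exists>y\<in>X. e dvd z + int k * d + d - y"
    using assms(1) unfolding invariant_mod_iff by blast
  then show ?case by (simp add: algebra_simps)
qed

text \<open>Negative multiples cost nothing: modulo \<open>e\<close> only \<open>k mod e\<close>
  matters, and that is a nonnegative number of steps.\<close>

lemma invariant_mod_mult_int:
  assumes "invariant_mod X d e" "x \<in> X" "e dvd z - x" "e > 0"
  shows "\<exists>y\<in>X. e dvd z + k * d - y"
proof -
  define k' where "k' = nat (k mod e)"
  have k': "int k' = k mod e"
    using assms(4) by (simp add: k'_def)
  obtain y where y: "y \<in> X" "e dvd z + int k' * d - y"
    using invariant_mod_mult[OF assms(1-3)] by blast
  have "e dvd (k - k mod e) * d"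
    by (simp add: minus_mod_eq_mult_div)
  from dvd_add[OF y(2) this] have "e dvd z + k * d - y"
    by (simp add: k' algebra_simps)
  then show ?thesis using y(1) by blast
qed

text \<open>The arithmetic counterpart of saturation. It lets invariance for any pair of divisors be
  read off from a chain of covering pairs, just as for a saturated transfer system.\<close>

lemma invariant_mod_chain:
  assumes "d dvd f" "f dvd e" "e > 0"
  shows "invariant_mod X d e \<longleftrightarrow> invariant_mod X d f \<and> invariant_mod X f e"
proof (intro iffI conjI)
  assume inv: "invariant_mod X d e"
  obtain k where "f = d * k" using assms(1) by blast
  then show "invariant_mod X f e"
    using invariant_mod_mult_int[OF inv _ _ assms(3), of _ _ k]
    unfolding invariant_mod_def by (simp add: mult.commute)
  show "invariant_mod X d f"
    unfolding invariant_mod_iff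
  proof clarify
    fix z x assume x: "x \<in> X" "f dvd z - x"
    obtain y where y: "y \<in> X" "e dvd x + d - y"
      using inv x(1) unfolding invariant_mod_iff by (metis diff_self dvd_0_right)
    have "f dvd (z - x) + (x + d - y)"
      using x(2) y(2) assms(2) by (meson dvd_add dvd_trans)
    then show "\<exists>x\<in>X. f dvd z + d - x"
      using y(1) by (auto intro!: bexI[of _ y] simp: algebra_simps)
  qed
next
  assume inv: "invariant_mod X d f \<and> invariant_mod X f e"
  show "invariant_mod X d e"
    unfolding invariant_mod_iff
  proof clarify
    fix z x assume x: "x \<in> X" "e dvd z - x"
    then obtain y where y: "y \<in> X" "f dvd z + d - y"
      using inv assms(2) unfolding invariant_mod_iff by (meson dvd_trans)
    \<comment> \<open>The point \<open>y\<close> hits \<open>z + d\<close> only modulo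
      \<open>f\<close>; the error is a multiple of \<open>f\<close>, which invariance under
      \<open>f\<close> modulo \<open>e\<close> removes.\<close>
    then obtain k where k: "z + d - y = f * k" by blast
    have "\<exists>y'\<in>X. e dvd y + k * f - y'"
      using invariant_mod_mult_int[of X f e y y k] inv y(1) assms(3) by simp
    then show "\<exists>x\<in>X. e dvd z + d - x"
      using k by (simp add: algebra_simps)
  qed
qed

section \<open>The covering pairs realised by the constructed set\<close>

context saturated_edges
begin

text \<open>Adding \<open>q ^ b\<close> does not change the residue modulo \<open>q ^ b\<close>, and
  its multiples run through all residues modulo \<open>p\<close> because \<open>q ^ b\<close> is a
  unit there. Invariance thus means that all fibres over Z/p coincide.\<close>

lemma exponents_horizontal:
  assumes "b \<le> n"
  shows "invariant_mod (exponents n) (q ^ b) (p * q ^ b) \<longleftrightarrow> h b"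
  unfolding invariant_mod_iff residues_exponents_pq[OF assms]
proof (subst admissible_horizontal, intro iffI allI impI)
  fix x x' y
  assume inv: "\<forall>z. (z, z) \<in> admissible b \<longrightarrow> (z + q ^ b, z + q ^ b) \<in> admissible b"
    and xy: "(x, y) \<in> admissible b"
  obtain z where z: "(z, z) \<in> admissible b" "p dvd z - x" "q ^ b dvd z - y"
    using admissible_exists_diagonal[OF xy] by blast
  have step: "(z + int k * q ^ b, z + int k * q ^ b) \<in> admissible b" for k
  proof (induction k)
    case (Suc k)
    then show ?case using inv[rule_format, OF Suc] by (simp add: algebra_simps)
  qed (use z(1) in simp)
  have "coprime p (q ^ b)"
    using coprime_p_q by simp
  then obtain w where w: "p dvd w - (x' - z)" "q ^ b dvd w - 0"
    by (rule chinese_remainder_int)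
  then obtain k where k: "w = q ^ b * k" by auto
  \<comment> \<open>\<open>step\<close> only allows a nonnegative number of translations, and
    \<open>k\<close> matters only modulo \<open>p\<close>.\<close>
  define k' where "k' = nat (k mod p)"
  have k': "int k' = k mod p"
    using p_gt by (simp add: k'_def)
  have "p dvd (k - k mod p) * q ^ b"
    by (simp add: minus_mod_eq_mult_div)
  from dvd_diff[OF w(1) this] have "p dvd x' - (z + int k' * q ^ b)"
    by (subst dvd_diff_commute) (simp add: k k' algebra_simps)
  moreover have "q ^ b dvd y - (z + int k' * q ^ b)"
    using dvd_diff[of "q ^ b" "y - z" "int k' * q ^ b"] z(3)
    by (simp add: dvd_diff_commute algebra_simps)
  ultimately show "(x', y) \<in> admissible b"
    using admissible_cong[OF step[of k'], of x' y] by blast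
next
  fix z
  assume "\<forall>x x' y. (x, y) \<in> admissible b \<longrightarrow> (x', y) \<in> admissible b" "(z, z) \<in> admissible b"
  then have "(z + q ^ b, z) \<in> admissible b" by blast
  then show "(z + q ^ b, z + q ^ b) \<in> admissible b"
    by (rule admissible_cong) auto
qed

lemma exponents_vertical_lower:
  assumes "b < n"
  shows "invariant_mod (exponents n) (q ^ b) (q ^ Suc b) \<longleftrightarrow> l b"
proof -
  have n: "Suc b \<le> n" using assms by simp
  show ?thesis
    unfolding invariant_mod_iff residues_exponents_q[OF n]
  proof (intro iffI allI impI)
    fix z assume "l b" "(0, z) \<in> admissible (Suc b)"
    moreover from this have "(0, z + q ^ b) \<in> admissible b"
      using admissible_cong[of 0 z b 0 "z + q ^ b"] admissible_Suc_subset by auto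
    ultimately show "(0, z + q ^ b) \<in> admissible (Suc b)"
      unfolding admissible_Suc_iff by simp
  next
    assume inv: "\<forall>z. (0, z) \<in> admissible (Suc b) \<longrightarrow> (0, z + q ^ b) \<in> admissible (Suc b)"
    show "l b"
    proof (rule ccontr)
      assume "\<not> l b"
      \<comment> \<open>Two translations, because one may land on the extra point
        \<open>(0, q ^ b)\<close>. The point \<open>2 * q ^ b\<close> is no small lift, and its
        differences from \<open>q ^ b\<close> and \<open>- (q ^ b)\<close> are 1 and 3 times
        \<open>q ^ b\<close>, not divisible by \<open>q ^ Suc b\<close>.\<close>
      have "(0, 0 + q ^ b + q ^ b) \<in> admissible (Suc b)"
        using inv zero_in_admissible by blast
      moreover have "0 + q ^ b + q ^ b = 2 * q ^ b" "2 * q ^ b - q ^ b = 1 * q ^ b"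
        "2 * q ^ b + q ^ b = 3 * q ^ b" by auto
      ultimately show False
        using \<open>\<not> l b\<close> u_imp_l[of b] multiple_notin_small_lifts[of 2 b]
          not_dvd_small_multiple[of 1 b] not_dvd_small_multiple[of 3 b]
        unfolding admissible_Suc_iff by (simp del: power_Suc)
    qed
  qed
qed

text \<open>The converse is tested on the fibre over 1, which the points added over 0 do not affect.
  Translations by \<open>p * q ^ b\<close> stay in this fibre and lead from \<open>(1, 0)\<close> to
  \<open>(1, q ^ b)\<close>, which is admissible only through \<open>u b\<close>.\<close>

lemma exponents_vertical_upper:
  assumes "b < n"
  shows "invariant_mod (exponents n) (p * q ^ b) (p * q ^ Suc b) \<longleftrightarrow> u b"
proof -
  have n: "Suc b \<le> n" using assms by simp
  show ?thesis
    unfolding invariant_mod_iff residues_exponents_pq[OF n]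
  proof (intro iffI allI impI)
    fix z assume "u b" "(z, z) \<in> admissible (Suc b)"
    moreover from this have "(z + p * q ^ b, z + p * q ^ b) \<in> admissible b"
      using admissible_cong[of z z b "z + p * q ^ b" "z + p * q ^ b"] admissible_Suc_subset
      by auto
    ultimately show "(z + p * q ^ b, z + p * q ^ b) \<in> admissible (Suc b)"
      unfolding admissible_Suc_iff by simp
  next
    assume inv: "\<forall>z. (z, z) \<in> admissible (Suc b) \<longrightarrow>
      (z + p * q ^ b, z + p * q ^ b) \<in> admissible (Suc b)"
    obtain z where z: "(z, z) \<in> admissible (Suc b)" "p dvd z - 1" "q ^ Suc b dvd z - 0"
      using admissible_exists_diagonal[OF one_in_admissible] by blast
    have step: "(z + int k * (p * q ^ b), z + int k * (p * q ^ b)) \<in> admissible (Suc b)" for k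
    proof (induction k)
      case (Suc k)
      then show ?case using inv[rule_format, OF Suc] by (simp add: algebra_simps)
    qed (use z(1) in simp)
    \<comment> \<open>The quotient \<open>k\<close> of \<open>w\<close> by \<open>p\<close> is an
      inverse of \<open>p\<close> modulo \<open>q\<close>, so that \<open>k\<close> translations by
      \<open>p * q ^ b\<close> add \<open>q ^ b\<close> modulo \<open>q ^ Suc b\<close>.\<close>
    obtain w where w: "p dvd w - 0" "q dvd w - 1"
      using coprime_p_q by (rule chinese_remainder_int)
    then obtain k where k: "w = p * k" by auto
    define k' where "k' = nat (k mod q)"
    have k': "int k' = k mod q"
      using q_gt by (simp add: k'_def)
    have "q dvd (k - k mod q) * p"
      by (simp add: minus_mod_eq_mult_div)
    from dvd_diff[OF w(2) this] have "q dvd p * int k' - 1"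
      by (simp add: k k' algebra_simps)
    then have "q * q ^ b dvd (p * int k' - 1) * q ^ b"
      by (rule mult_dvd_mono) simp
    then have "q ^ Suc b dvd z + (p * int k' - 1) * q ^ b"
      using z(3) by (auto intro: dvd_add)
    then have "q ^ Suc b dvd q ^ b - (z + int k' * (p * q ^ b))"
      by (subst dvd_diff_commute) (simp add: algebra_simps)
    moreover have "p dvd 1 - (z + int k' * (p * q ^ b))"
    proof -
      have "p dvd 1 - z"
        using z(2) by (simp add: dvd_diff_commute)
      then have "p dvd (1 - z) - p * (int k' * q ^ b)"
        by (rule dvd_diff) simp
      then show ?thesis by (simp add: algebra_simps)
    qed
    ultimately have "(1, q ^ b) \<in> admissible (Suc b)"
      using admissible_cong[OF step[of k'], of 1 "q ^ b"] by blast
    then show "u b"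
      using multiple_notin_small_lifts[of 1 b] p_gt unfolding admissible_Suc_iff by auto
  qed
qed

lemma zero_in_exponents: "0 \<in> exponents n"
  by (simp add: exponents_def zero_in_admissible)

lemma uminus_in_exponents: "x \<in> exponents n \<Longrightarrow> - x \<in> exponents n"
  by (simp add: exponents_def admissible_uminus)

end

text \<open>The group-free core: \<open>D\<close> is the transfer system read on orders of
  subgroups. Since \<open>chain\<close> and \<open>invariant_mod_chain\<close> are both
  equivalences, agreement on covering pairs suffices.\<close>

lemma saturated_divisor_relation_realizable:
  fixes D :: "nat \<Rightarrow> nat \<Rightarrow> bool" and p q n :: nat
  assumes prime: "Factorial_Ring.prime p" "Factorial_Ring.prime q" "p \<noteq> q" "p > 3" "q > 3"
    and dvd: "\<And>d e. D d e \<Longrightarrow> e dvd p * q ^ n"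
    and refl: "\<And>d. d dvd p * q ^ n \<Longrightarrow> D d d"
    and chain: "\<And>d e f. d dvd f \<Longrightarrow> f dvd e \<Longrightarrow> e dvd p * q ^ n \<Longrightarrow> D d e \<longleftrightarrow> D d f \<and> D f e"
    and restrict: "\<And>d e m. D d e \<Longrightarrow> m dvd e \<Longrightarrow> D (gcd d m) m"
  obtains X :: "int set" where "0 \<in> X" "\<And>x. x \<in> X \<Longrightarrow> - x \<in> X"
    "\<And>d e. d dvd e \<Longrightarrow> e dvd p * q ^ n \<Longrightarrow> D d e \<longleftrightarrow> invariant_mod X (int d) (int e)"
proof -
  \<comment> \<open>These are defined for every \<open>b\<close>; past the top level they are false
    by \<open>dvd\<close>, so the locale axioms need no bound on \<open>b\<close>.\<close>
  define h l u where "h b = D (q ^ b) (p * q ^ b)" and "l b = D (q ^ b) (q ^ Suc b)"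
    and "u b = D (p * q ^ b) (p * q ^ Suc b)" for b
  have coprime: "coprime p q"
    using prime by (simp add: primes_coprime)
  have gcd1: "gcd (q ^ Suc b) (p * q ^ b) = q ^ b" for b
  proof -
    have "gcd (q ^ Suc b) (p * q ^ b) = gcd (q ^ b * q) (q ^ b * p)"
      by (simp add: mult.commute)
    also have "\<dots> = q ^ b * gcd q p"
      by (rule gcd_mult_distrib_nat[symmetric])
    finally show ?thesis
      using coprime by (simp add: coprime_iff_gcd_eq_1 gcd.commute)
  qed
  interpret saturated_edges "int p" "int q" h l u
  proof
    show "int p > 3" "int q > 3" "coprime (int p) (int q)"
      using prime coprime by auto
    fix b
    show "h b" if "h (Suc b)"
      using restrict[of "q ^ Suc b" "p * q ^ Suc b" "p * q ^ b"] that gcd1[of b]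
      by (simp add: h_def)
    show "l b" if "u b"
      using restrict[of "p * q ^ b" "p * q ^ Suc b" "q ^ Suc b"] that gcd1[of b]
      by (simp add: u_def l_def gcd.commute)
    show "u b" if "h (Suc b)" "l b"
    proof -
      have N: "p * q ^ Suc b dvd p * q ^ n"
        using that(1) dvd unfolding h_def by blast
      have "D (q ^ b) (p * q ^ Suc b)"
        using that chain[of "q ^ b" "q ^ Suc b", OF _ _ N] by (simp add: h_def l_def)
      then show ?thesis
        using chain[of "q ^ b" "p * q ^ b", OF _ _ N] by (simp add: u_def)
    qed
    show "h (Suc b)" if "h b" "u b"
    proof -
      have N: "p * q ^ Suc b dvd p * q ^ n"
        using that(2) dvd unfolding u_def by blast
      have "D (q ^ b) (p * q ^ Suc b)"
        using that chain[of "q ^ b" "p * q ^ b", OF _ _ N] by (simp add: h_def u_def)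
      then show ?thesis
        using chain[of "q ^ b" "q ^ Suc b", OF _ _ N] by (simp add: h_def)
    qed
  qed
  define X where "X = exponents n"
  have cover: "D d (d * r) \<longleftrightarrow> invariant_mod X (int d) (int (d * r))"
    if r: "Factorial_Ring.prime r" and dr: "d * r dvd p * q ^ n" for d r
  proof -
    have "r dvd p * q ^ n"
      using dr by (metis dvd_mult_right)
    then have "r = p \<or> r = q"
      using r prime by (metis prime_dvd_mult_iff prime_dvd_power primes_dvd_imp_eq)
    then show ?thesis
    proof
      assume [simp]: "r = p"
      have "d dvd q ^ n"
        using dr prime by (simp add: mult.commute)
      then obtain b where b: "b \<le> n" "d = q ^ b"
        using prime by (auto simp: divides_primepow_nat)
      then show ?thesis
        using exponents_horizontal[of b n] by (simp add: X_def h_def mult.commute)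
    next
      assume [simp]: "r = q"
      have "n \<noteq> 0"
      proof
        assume "n = 0"
        then have "q dvd p" using dr by (metis \<open>r = q\<close> dvd_mult_right mult.right_neutral power_0)
        then show False using prime by (metis primes_dvd_imp_eq)
      qed
      then obtain m where m: "n = Suc m" by (cases n) auto
      have d: "d dvd p * q ^ m"
      proof -
        have "d * q dvd (p * q ^ m) * q" using dr by (simp add: m mult_ac)
        then show ?thesis using prime by auto
      qed
      show ?thesis
      proof (cases "p dvd d")
        case True
        then obtain d' where d': "d = p * d'" by blast
        then have "d' dvd q ^ m" using d prime by auto
        then obtain b where b: "b \<le> m" "d' = q ^ b"
          using prime by (auto simp: divides_primepow_nat)
        then show ?thesis
          using exponents_vertical_upper[of b n] d' m by (simp add: X_def u_def mult_ac)
      next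
        case False
        then have "coprime d p"
          using prime by (metis coprime_commute prime_imp_coprime)
        then have "d dvd q ^ m"
          using d by (simp add: coprime_dvd_mult_right_iff)
        then obtain b where b: "b \<le> m" "d = q ^ b"
          using prime by (auto simp: divides_primepow_nat)
        then show ?thesis
          using exponents_vertical_lower[of b n] m by (simp add: X_def l_def mult_ac)
      qed
    qed
  qed
  have "D d (d * k) \<longleftrightarrow> invariant_mod X (int d) (int (d * k))" if "d * k dvd p * q ^ n" for d k
    using that
  proof (induction k arbitrary: d rule: less_induct)
    case (less k)
    have "p * q ^ n > 0"
      using prime by simp
    then have "d * k > 0"
      using less.prems by (rule dvd_pos_nat)
    then have pos: "d > 0" "k > 0" by auto
    show ?case
    proof (cases "k = 1")
      case True
      then show ?thesis using less.prems refl by (simp add: invariant_mod_refl)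
    next
      case False
      \<comment> \<open>Splitting off one prime factor at the bottom makes \<open>d\<close> to
        \<open>d * r\<close> a covering pair and leaves \<open>d * r\<close> to \<open>d * k\<close>
        to the induction.\<close>
      then obtain r where r: "Factorial_Ring.prime r" "r dvd k"
        using prime_factor_nat by blast
      then obtain k' where k': "k = r * k'" by blast
      then have "k' < k"
        using pos r(1) prime_gt_1_nat[of r] by auto
      have e: "d * k = d * r * k'"
        using k' by simp
      have dr: "d * r dvd p * q ^ n"
        using less.prems unfolding e by (rule dvd_mult_left)
      have "D d (d * k) \<longleftrightarrow> D d (d * r) \<and> D (d * r) (d * k)"
        by (rule chain) (use less.prems e in auto)
      also have "\<dots> \<longleftrightarrow> invariant_mod X (int d) (int (d * r)) \<and>
          invariant_mod X (int (d * r)) (int (d * k))"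
        unfolding e using less.IH[OF \<open>k' < k\<close>, of "d * r"] less.prems cover[OF r(1) dr]
        by (simp add: e)
      also have "\<dots> \<longleftrightarrow> invariant_mod X (int d) (int (d * k))"
        by (rule invariant_mod_chain[symmetric]) (use e pos in auto)
      finally show ?thesis .
    qed
  qed
  then show ?thesis
    using that[of X] zero_in_exponents uminus_in_exponents unfolding X_def dvd_def by blast
qed

section \<open>Complex coordinates\<close>

text \<open>The universe must live on real sequences; pairing neighbouring entries into complex
  numbers makes the characters act diagonally by multiplication.\<close>

definition coord :: "(nat \<Rightarrow>\<^sub>0 real) \<Rightarrow> nat \<Rightarrow> complex"
  where "coord v m = Complex (Poly_Mapping.lookup v (2 * m)) (Poly_Mapping.lookup v (2 * m + 1))"

definition of_coords :: "(nat \<Rightarrow> complex) \<Rightarrow> nat \<Rightarrow>\<^sub>0 real"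
  where "of_coords c =
    Abs_poly_mapping (\<lambda>i. if even i then Re (c (i div 2)) else Im (c (i div 2)))"

lemma coord_of_coords:
  assumes "finite {m. c m \<noteq> 0}"
  shows "coord (of_coords c) = c"
proof -
  let ?f = "\<lambda>i. if even i then Re (c (i div 2)) else Im (c (i div 2))"
  have "{i. ?f i \<noteq> 0} \<subseteq> (\<lambda>m. 2 * m) ` {m. c m \<noteq> 0} \<union> (\<lambda>m. 2 * m + 1) ` {m. c m \<noteq> 0}"
  proof
    fix i assume "i \<in> {i. ?f i \<noteq> 0}"
    then have "c (i div 2) \<noteq> 0" by (auto split: if_splits)
    moreover have "i = 2 * (i div 2) \<or> i = 2 * (i div 2) + 1" by presburger
    ultimately show "i \<in> (\<lambda>m. 2 * m) ` {m. c m \<noteq> 0} \<union> (\<lambda>m. 2 * m + 1) ` {m. c m \<noteq> 0}"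
      by blast
  qed
  then have "finite {i. ?f i \<noteq> 0}"
    using assms by (blast intro: finite_subset)
  then show ?thesis
    by (auto simp: fun_eq_iff coord_def of_coords_def complex_eq_iff)
qed

lemma coord_inject: "coord u = coord v \<longleftrightarrow> u = v"
proof
  assume eq: "coord u = coord v"
  have "Poly_Mapping.lookup u i = Poly_Mapping.lookup v i" for i
  proof (cases "even i")
    case True
    then obtain m where "i = 2 * m" by blast
    then show ?thesis using fun_cong[OF eq, of m] by (simp add: coord_def)
  next
    case False
    then obtain m where "i = 2 * m + 1" by (rule oddE)
    then show ?thesis using fun_cong[OF eq, of m] by (simp add: coord_def)
  qed
  then show "u = v" by (rule poly_mapping_eqI)
qed simp

lemma finite_support_coord [simp]: "finite {m. coord v m \<noteq> 0}"
proof (rule finite_subset)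
  show "{m. coord v m \<noteq> 0} \<subseteq> (\<lambda>i. i div 2) ` Poly_Mapping.keys v"
  proof
    fix m assume "m \<in> {m. coord v m \<noteq> 0}"
    then have "2 * m \<in> Poly_Mapping.keys v \<or> 2 * m + 1 \<in> Poly_Mapping.keys v"
      by (auto simp: coord_def complex_eq_iff in_keys_iff)
    moreover have "m = (2 * m) div 2" "m = (2 * m + 1) div 2" by auto
    ultimately show "m \<in> (\<lambda>i. i div 2) ` Poly_Mapping.keys v" by blast
  qed
qed simp

lemma coord_add [simp]: "coord (u + v) m = coord u m + coord v m"
  by (simp add: coord_def lookup_add complex_eq_iff)

lemma coord_scaleR [simp]: "coord (c *\<^sub>R v) m = c *\<^sub>R coord v m"
  by (simp add: coord_def lookup_scaleR complex_eq_iff)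

lemma coord_zero [simp]: "coord 0 m = 0"
  by (simp add: coord_def complex_eq_iff)

lemma inner_coord:
  assumes "finite F" "{m. coord u m \<noteq> 0} \<subseteq> F"
  shows "inner u v = (\<Sum>m\<in>F. inner (coord u m) (coord v m))"
proof -
  let ?t = "\<lambda>i. inner (Poly_Mapping.lookup u i) (Poly_Mapping.lookup v i)"
  have "Poly_Mapping.keys u \<subseteq> (\<lambda>m. 2 * m) ` F \<union> (\<lambda>m. 2 * m + 1) ` F"
  proof
    fix i assume "i \<in> Poly_Mapping.keys u"
    moreover have i: "i = 2 * (i div 2) \<or> i = 2 * (i div 2) + 1" by presburger
    ultimately have "coord u (i div 2) \<noteq> 0"
      by (auto simp: coord_def complex_eq_iff in_keys_iff)
    then show "i \<in> (\<lambda>m. 2 * m) ` F \<union> (\<lambda>m. 2 * m + 1) ` F"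
      using i assms(2) by blast
  qed
  then have "inner u v = sum ?t ((\<lambda>m. 2 * m) ` F \<union> (\<lambda>m. 2 * m + 1) ` F)"
    using assms(1) by (intro inner_poly_mapping_superset) auto
  also have "\<dots> = sum ?t ((\<lambda>m. 2 * m) ` F) + sum ?t ((\<lambda>m. 2 * m + 1) ` F)"
    using assms(1) by (intro sum.union_disjoint) (auto, presburger)
  also have "\<dots> = (\<Sum>m\<in>F. ?t (2 * m)) + (\<Sum>m\<in>F. ?t (2 * m + 1))"
    by (simp add: sum.reindex inj_on_def)
  also have "\<dots> = (\<Sum>m\<in>F. inner (coord u m) (coord v m))"
    by (simp add: coord_def inner_complex_def sum.distrib)
  finally show ?thesis .
qed

lemma eq_coordI: "(\<And>m. coord u m = coord v m) \<Longrightarrow> u = v"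
  using coord_inject by blast

lemma inner_complex_mult_left:
  fixes z :: complex
  shows "inner (z * u) (z * v) = (norm z)\<^sup>2 * inner u v"
  unfolding inner_complex_def cmod_power2 by (simp add: algebra_simps power2_eq_square)

text \<open>Moves the coordinate \<open>i \<in> S\<close> to position \<open>\<tau> i\<close>; meaningful only for \<open>\<tau>\<close> injective on \<open>S\<close>.\<close>

definition push :: "'i set \<Rightarrow> ('i \<Rightarrow> nat) \<Rightarrow> ('i \<Rightarrow> complex) \<Rightarrow> nat \<Rightarrow> complex"
  where "push S \<tau> c k = (if k \<in> \<tau> ` S then c (the_inv_into S \<tau> k) else 0)"

lemma push_apply: "inj_on \<tau> S \<Longrightarrow> i \<in> S \<Longrightarrow> push S \<tau> c (\<tau> i) = c i"
  by (simp add: push_def the_inv_into_f_f)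

lemma push_outside: "k \<notin> \<tau> ` S \<Longrightarrow> push S \<tau> c k = 0"
  by (simp add: push_def)

lemma support_push:
  assumes "inj_on \<tau> S"
  shows "{k. push S \<tau> c k \<noteq> 0} \<subseteq> \<tau> ` {i \<in> S. c i \<noteq> 0}"
  using assms by (auto simp: push_def the_inv_into_f_f split: if_splits)

lemma coord_of_coords_push:
  assumes "inj_on \<tau> S" "finite {i \<in> S. c i \<noteq> 0}"
  shows "coord (of_coords (push S \<tau> c)) = push S \<tau> c"
  using assms by (intro coord_of_coords finite_subset[OF support_push]) auto

lemma inner_of_coords_push:
  assumes "inj_on \<tau> S" "finite F" "F \<subseteq> S"
    and "{i \<in> S. c i \<noteq> 0} \<subseteq> F" "{i \<in> S. c' i \<noteq> 0} \<subseteq> F"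
  shows "inner (of_coords (push S \<tau> c)) (of_coords (push S \<tau> c')) = (\<Sum>i\<in>F. inner (c i) (c' i))"
proof -
  have fin: "finite {i \<in> S. c i \<noteq> 0}" "finite {i \<in> S. c' i \<noteq> 0}"
    using assms by (auto intro: finite_subset)
  have "{k. push S \<tau> c k \<noteq> 0} \<subseteq> \<tau> ` F"
    using support_push[OF assms(1), of c] assms(4) by blast
  then have "inner (of_coords (push S \<tau> c)) (of_coords (push S \<tau> c')) =
      (\<Sum>k\<in>\<tau> ` F. inner (push S \<tau> c k) (push S \<tau> c' k))"
    using inner_coord[of "\<tau> ` F" "of_coords (push S \<tau> c)" "of_coords (push S \<tau> c')"]
      assms(1,2) fin
    by (simp add: coord_of_coords_push)
  also have "\<dots> = (\<Sum>i\<in>F. inner (c i) (c' i))"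
    using assms(1,3)
    by (subst sum.reindex) (auto simp: push_apply subset_iff intro: inj_on_subset intro!: sum.cong)
  finally show ?thesis .
qed

section \<open>Faithful characters\<close>

lemma cis_eq_1_imp_multiple:
  assumes "cis t = 1"
  obtains k :: int where "t = 2 * pi * of_int k"
proof -
  have "exp (\<i> * complex_of_real t) = 1"
    using assms by (simp add: cis_conv_exp)
  then obtain n :: int where "t = of_int (2 * n) * pi"
    by (auto simp: exp_eq_1)
  then show ?thesis
    using that[of n] by (simp add: algebra_simps)
qed

lemma cis_root_powi_eq_iff:
  fixes e :: nat
  assumes "e > 0"
  shows "cis (2 * pi / real e) powi j = cis (2 * pi / real e) powi k \<longleftrightarrow> int e dvd j - k"
proof
  assume "cis (2 * pi / real e) powi j = cis (2 * pi / real e) powi k"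
  then have "cis (2 * pi / real e) powi (j - k) = 1"
    by (simp add: power_int_diff)
  then obtain n :: int where "of_int (j - k) * (2 * pi / real e) = 2 * pi * of_int n"
    unfolding cis_power_int by (rule cis_eq_1_imp_multiple)
  then have "(2 * pi) * real_of_int (j - k) = (2 * pi) * real_of_int (int e * n)"
    using assms by (simp add: field_simps)
  then have "real_of_int (j - k) = real_of_int (int e * n)"
    by (subst (asm) mult_cancel_left) simp
  then show "int e dvd j - k"
    by (simp only: of_int_eq_iff) simp
next
  assume "int e dvd j - k"
  then obtain n where "j - k = int e * n" by blast
  then have j: "j = k + int e * n" by simp
  have "cis (2 * pi / real e) powi (int e * n) = 1"
  proof -
    have "of_int (int e * n) * (2 * pi / real e) = 2 * pi * of_int n"
      using assms by (simp add: field_simps)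
    then show ?thesis
      unfolding cis_power_int by (simp only: cis_multiple_2pi Ints_of_int)
  qed
  then show "cis (2 * pi / real e) powi j = cis (2 * pi / real e) powi k"
    unfolding j by (simp add: power_int_add)
qed

lemma (in group) l_coset_eqD:
  assumes "x <# K = y <# K" "subgroup K G" "x \<in> carrier G" "y \<in> carrier G"
  obtains k where "k \<in> K" "x = y \<otimes> k"
  using lcos_self[OF assms(3,2)] assms(1) by (auto simp: l_coset_def)

locale faithful_character = comm_group G for G :: "('a, 'b) monoid_scheme" (structure) +
  fixes \<theta> :: "'a \<Rightarrow> complex"
  assumes finite_G: "finite (carrier G)"
    and \<theta>_one: "\<theta> \<one> = 1"
    and \<theta>_mult: "x \<in> carrier G \<Longrightarrow> y \<in> carrier G \<Longrightarrow> \<theta> (x \<otimes> y) = \<theta> x * \<theta> y"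
    and inj_\<theta>: "inj_on \<theta> (carrier G)"
begin

lemma \<theta>_pow: "x \<in> carrier G \<Longrightarrow> \<theta> (x [^] (n::nat)) = \<theta> x ^ n"
  by (induction n) (simp_all add: \<theta>_one \<theta>_mult)

lemma \<theta>_inv: "x \<in> carrier G \<Longrightarrow> \<theta> (inv x) = inverse (\<theta> x)"
  using \<theta>_mult[of x "inv x"] inverse_unique[of "\<theta> x" "\<theta> (inv x)"] by (simp add: \<theta>_one)

lemma norm_\<theta> [simp]: "x \<in> carrier G \<Longrightarrow> norm (\<theta> x) = 1"
proof -
  assume x: "x \<in> carrier G"
  have "\<theta> x ^ order G = 1"
    using \<theta>_pow[OF x, of "order G"] pow_order_eq_1[OF x] by (simp add: \<theta>_one)
  then have "norm (\<theta> x) ^ order G = 1"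
    by (metis norm_one norm_power)
  moreover have "order G > 0"
    using finite_G order_gt_0_iff_finite by blast
  ultimately show ?thesis
    using power_eq_imp_eq_base[of "norm (\<theta> x)" "order G" 1] by simp
qed

lemma \<theta>_nonzero [simp]: "x \<in> carrier G \<Longrightarrow> \<theta> x \<noteq> 0"
  using norm_\<theta> by fastforce

lemma norm_\<theta>_powi [simp]: "x \<in> carrier G \<Longrightarrow> norm (\<theta> x powi k) = 1"
  by (simp add: norm_power_int)

lemma pow_card_subgroup:
  assumes "subgroup H G" "x \<in> H"
  shows "x [^] card H = \<one>"
proof -
  interpret H: group "G\<lparr>carrier := H\<rparr>"
    by (rule subgroup_imp_group[OF assms(1)])
  show ?thesis
    using H.pow_order_eq_1[of x] assms(2) by (simp add: order_def nat_pow_consistent[symmetric])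
qed

lemma card_subgroup_pos: "subgroup H G \<Longrightarrow> card H > 0"
  using finite_G by (metis card_gt_0_iff empty_iff finite_subset subgroup.one_closed subgroup.subset)

text \<open>A count: injectivity of \<open>\<theta>\<close> puts \<open>card H\<close> elements
  among the \<open>card H\<close> roots of unity of that order. In consequence a subgroup is
  determined by its order.\<close>

lemma \<theta>_image_subgroup:
  assumes "subgroup H G"
  shows "\<theta> ` H = {z. z ^ card H = 1}"
proof (rule card_subset_eq)
  show "finite {z::complex. z ^ card H = 1}"
    using card_subgroup_pos[OF assms] by (intro finite_roots_unity) simp
  have "\<theta> x ^ card H = 1" if "x \<in> H" for x
    using \<theta>_pow[of x "card H"] pow_card_subgroup[OF assms that]
      subgroup.mem_carrier[OF assms that] by (simp add: \<theta>_one)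
  then show "\<theta> ` H \<subseteq> {z. z ^ card H = 1}" by blast
  have "card (\<theta> ` H) = card H"
    using inj_\<theta> subgroup.subset[OF assms] by (intro card_image) (rule inj_on_subset)
  then show "card (\<theta> ` H) = card {z::complex. z ^ card H = 1}"
    using card_subgroup_pos[OF assms] by (simp add: card_complex_roots_unity Suc_le_eq)
qed

lemma mem_subgroup_iff:
  assumes "subgroup H G" "x \<in> carrier G"
  shows "x \<in> H \<longleftrightarrow> \<theta> x ^ card H = 1"
proof -
  have "\<theta> x \<in> \<theta> ` H \<longleftrightarrow> x \<in> H"
    using inj_on_image_mem_iff[OF inj_\<theta> assms(2) subgroup.subset[OF assms(1)]] .
  then show ?thesis
    unfolding \<theta>_image_subgroup[OF assms(1)] by simp
qed

lemma \<theta>_powi_subgroup: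
  assumes "subgroup H G" "x \<in> H" "int (card H) dvd k"
  shows "\<theta> x powi k = 1"
proof -
  obtain j where "k = int (card H) * j" using assms(3) by blast
  moreover have "\<theta> x ^ card H = 1"
    using mem_subgroup_iff[OF assms(1)] assms(2) subgroup.subset[OF assms(1)] by blast
  ultimately show ?thesis
    by (simp add: power_int_mult)
qed

text \<open>The value is a primitive root of unity, so equality of two powers of
  \<open>\<theta> h\<close> is exactly congruence of the exponents modulo
  \<open>card H\<close>.\<close>

lemma subgroup_generator:
  assumes "subgroup H G"
  obtains h where "h \<in> H" "\<theta> h = cis (2 * pi / real (card H))"
proof -
  have "cis (2 * pi / real (card H)) ^ card H = 1"
    using card_subgroup_pos[OF assms] by (simp add: Complex.DeMoivre)
  then have "cis (2 * pi / real (card H)) \<in> \<theta> ` H"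
    unfolding \<theta>_image_subgroup[OF assms] by simp
  with that show ?thesis by force
qed

lemma left_cosets_in_eq: "left_cosets_in G H K = (\<lambda>x. x <# K) ` H"
  by (auto simp: left_cosets_in_def LCOSETS_def)

lemma subgroup_index_mult_card:
  assumes "subgroup K G" "subgroup H G" "K \<subseteq> H"
  shows "subgroup_index G H K * card K = card H"
proof -
  interpret H: group "G\<lparr>carrier := H\<rparr>"
    by (rule subgroup_imp_group[OF assms(2)])
  have "subgroup K (G\<lparr>carrier := H\<rparr>)"
    using assms by (simp add: subgroup_incl)
  moreover have "finite H"
    using finite_G subgroup.subset[OF assms(2)] by (rule finite_subset[rotated])
  ultimately show ?thesis
    using H.l_lagrange[of K] by (simp add: subgroup_index_def left_cosets_in_def order_def)
qed

lemma coset_representatives: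
  assumes "bij_betw b {1..r} (left_cosets_in G H K)"
  obtains t where "\<And>i. i \<in> {1..r} \<Longrightarrow> t i \<in> H" "\<And>i. i \<in> {1..r} \<Longrightarrow> b i = t i <# K"
proof -
  have "\<exists>x\<in>H. b i = x <# K" if "i \<in> {1..r}" for i
  proof -
    have "b i \<in> left_cosets_in G H K"
      using bij_betwE[OF assms] that by blast
    then show ?thesis by (auto simp: left_cosets_in_eq)
  qed
  then show ?thesis using that by metis
qed

lemma exists_coset_permutation_rep:
  assumes "subgroup K G" "subgroup H G" "K \<subseteq> H"
  obtains \<sigma> where "coset_permutation_rep G H K \<sigma>"
proof -
  let ?r = "subgroup_index G H K" and ?C = "left_cosets_in G H K"
  note Hc = subgroup.mem_carrier[OF assms(2)]
  have Kc: "K \<subseteq> carrier G" using subgroup.subset[OF assms(1)] .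
  have "finite H"
    using finite_G subgroup.subset[OF assms(2)] by (rule finite_subset[rotated])
  then have "finite ?C"
    by (simp add: left_cosets_in_eq)
  then obtain b where b: "bij_betw b {1..?r} ?C"
    using ex_bij_betw_nat_finite_1 unfolding subgroup_index_def by blast
  \<comment> \<open>Left translation of cosets, read through the enumeration \<open>b\<close>; it is
    the identity outside the range because \<open>permutes\<close> demands it.\<close>
  define \<sigma> where "\<sigma> h i = (if i \<in> {1..?r} then the_inv_into {1..?r} b (h <# b i) else i)" for h i
  have closed: "h <# c \<in> ?C" if "h \<in> H" "c \<in> ?C" for h c
    using that Kc Hc subgroup.m_closed[OF assms(2)]
    by (auto simp: left_cosets_in_eq lcos_m_assoc)
  have assoc: "h <# (h' <# c) = (h \<otimes> h') <# c" if "h \<in> H" "h' \<in> H" "c \<in> ?C" for h h' c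
    using that Kc Hc by (auto simp: left_cosets_in_eq lcos_m_assoc m_assoc)
  have one: "\<one> <# c = c" if "c \<in> ?C" for c
    using that Kc Hc by (auto simp: left_cosets_in_eq lcos_m_assoc)
  have inj: "inj_on b {1..?r}" and img: "b ` {1..?r} = ?C"
    using b by (auto simp: bij_betw_def)
  have bC: "b i \<in> ?C" if "i \<in> {1..?r}" for i
    using img that by blast
  have b\<sigma>: "b (\<sigma> h i) = h <# b i" "\<sigma> h i \<in> {1..?r}" if "h \<in> H" "i \<in> {1..?r}" for h i
    using that closed[OF that(1) bC[OF that(2)]] f_the_inv_into_f[OF inj, of "h <# b i"]
      the_inv_into_into[OF inj, of "h <# b i" "{1..?r}"] img
    by (auto simp: \<sigma>_def)
  have perm: "\<sigma> h permutes {1..?r}" if h: "h \<in> H" for h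
  proof (rule bij_imp_permutes)
    have "inj_on (\<sigma> h) {1..?r}"
    proof (rule inj_onI)
      fix i j assume ij: "i \<in> {1..?r}" "j \<in> {1..?r}" "\<sigma> h i = \<sigma> h j"
      then have "h <# b i = h <# b j"
        using b\<sigma>(1)[OF h] by metis
      then have "inv h <# (h <# b i) = inv h <# (h <# b j)" by simp
      then have "b i = b j"
        using h ij bC one Hc by (simp add: assoc subgroup.m_inv_closed[OF assms(2)])
      then show "i = j" using inj ij by (auto dest: inj_onD)
    qed
    moreover have "\<sigma> h ` {1..?r} \<subseteq> {1..?r}"
      using b\<sigma>(2)[OF h] by blast
    ultimately show "bij_betw (\<sigma> h) {1..?r} {1..?r}"
      by (simp add: bij_betw_def endo_inj_surj)
    show "\<sigma> h i = i" if "i \<notin> {1..?r}" for i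
      using that by (simp add: \<sigma>_def del: atLeastAtMost_iff)
  qed
  have "\<sigma> (h \<otimes> h') i = \<sigma> h (\<sigma> h' i)" if h: "h \<in> H" "h' \<in> H" for h h' i
  proof (cases "i \<in> {1..?r}")
    case True
    have "b (\<sigma> (h \<otimes> h') i) = b (\<sigma> h (\<sigma> h' i))"
      using True h b\<sigma> bC by (simp add: assoc subgroup.m_closed[OF assms(2)] del: atLeastAtMost_iff)
    then show ?thesis
      using inj_onD[OF inj] True h b\<sigma>(2) subgroup.m_closed[OF assms(2)] by metis
  next
    case False
    then show ?thesis by (simp add: \<sigma>_def del: atLeastAtMost_iff)
  qed
  then have "\<sigma> \<in> hom (G\<lparr>carrier := H\<rparr>) (sym_group ?r)"
    using perm by (auto simp: hom_def sym_group_def)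
  then have "coset_permutation_rep G H K \<sigma>"
    unfolding coset_permutation_rep_def using b b\<sigma>(1) by blast
  with that show ?thesis by blast
qed

text \<open>When \<open>card K\<close> divides \<open>k\<close>, the power \<open>\<theta>\<close>
  to the \<open>k\<close> is trivial on \<open>K\<close>, so it is a character of \<open>H/K\<close>
  and its value does not depend on the representative.\<close>

lemma \<theta>_powi_coset_representative:
  assumes KH: "subgroup K G" "subgroup H G" "K \<subseteq> H"
    and t: "\<And>i. i \<in> {1..r} \<Longrightarrow> t i \<in> H" "\<And>i. i \<in> {1..r} \<Longrightarrow> b i = t i <# K"
    and ij: "i \<in> {1..r}" "j \<in> {1..r}" "b j = h <# b i" and h: "h \<in> H"
    and k: "int (card K) dvd k"
  shows "\<theta> (t j) powi k = \<theta> h powi k * \<theta> (t i) powi k"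
proof -
  note Hc = subgroup.mem_carrier[OF KH(2)]
  have "t j <# K = (h \<otimes> t i) <# K"
    using t ij h Hc subgroup.subset[OF KH(1)] by (simp add: lcos_m_assoc del: atLeastAtMost_iff)
  then obtain x where x: "x \<in> K" "t j = h \<otimes> t i \<otimes> x"
    using l_coset_eqD[OF _ KH(1)] t(1) ij h Hc by (metis m_closed)
  have "x \<in> carrier G" using x(1) subgroup.mem_carrier[OF KH(1)] by blast
  then have "\<theta> (t j) = \<theta> h * \<theta> (t i) * \<theta> x"
    using x(2) t(1)[OF ij(1)] h Hc by (simp add: \<theta>_mult)
  then show ?thesis
    using \<theta>_powi_subgroup[OF KH(1) x(1) k] by (simp add: power_int_mult_distrib)
qed

text \<open>Orthogonality of two cosets, summed over the characters of \<open>H/K\<close>. Each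
  summand is a power of one root of unity of order dividing the index, equal to 1 only if the cosets
  agree; the rest is a geometric sum.\<close>

lemma coset_character_orthogonality:
  assumes KH: "subgroup K G" "subgroup H G" "K \<subseteq> H"
    and b: "bij_betw b {1..subgroup_index G H K} (left_cosets_in G H K)"
    and t: "\<And>i. i \<in> {1..subgroup_index G H K} \<Longrightarrow> t i \<in> H"
      "\<And>i. i \<in> {1..subgroup_index G H K} \<Longrightarrow> b i = t i <# K"
    and ij: "i \<in> {1..subgroup_index G H K}" "j \<in> {1..subgroup_index G H K}"
  shows "(\<Sum>s<subgroup_index G H K. cnj (\<theta> (t i) powi (int (card K) * int s)) *
      \<theta> (t j) powi (int (card K) * int s)) =
    (if i = j then of_nat (subgroup_index G H K) else 0)"
proof -
  let ?r = "subgroup_index G H K"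
  let ?y = "inv (t i) \<otimes> t j"
  let ?\<omega> = "\<theta> ?y ^ card K"
  note Hc = subgroup.mem_carrier[OF KH(2)]
  have y: "?y \<in> H"
    using t(1) ij subgroup.m_closed[OF KH(2)] subgroup.m_inv_closed[OF KH(2)] by blast
  have ti: "t i \<in> carrier G" and tj: "t j \<in> carrier G"
    using t(1) ij Hc by blast+
  have summand: "cnj (\<theta> (t i) powi (int (card K) * int s)) * \<theta> (t j) powi (int (card K) * int s) = ?\<omega> ^ s"
    for s
  proof -
    have "cnj (\<theta> (t i)) = inverse (\<theta> (t i))"
      using inverse_unique[of "\<theta> (t i)" "cnj (\<theta> (t i))"] complex_norm_square[of "\<theta> (t i)"]
        norm_\<theta>[OF ti] by simp
    then show ?thesis
      using ti tj by (simp add: \<theta>_mult \<theta>_inv power_mult_distrib flip: of_nat_mult power_mult)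
  qed
  have "?\<omega> ^ ?r = \<theta> ?y ^ card H"
    using subgroup_index_mult_card[OF KH] by (simp add: mult.commute flip: power_mult)
  then have root: "?\<omega> ^ ?r = 1"
    using mem_subgroup_iff[OF KH(2) Hc[OF y]] y by simp
  have "?\<omega> = 1 \<longleftrightarrow> i = j"
  proof
    assume "?\<omega> = 1"
    then have "?y \<in> K"
      using mem_subgroup_iff[OF KH(1) Hc[OF y]] by simp
    then have "t j \<in> t i <# K"
      using ti tj by (auto simp: l_coset_def m_assoc[symmetric] intro!: bexI[of _ ?y])
    then have "t i <# K = t j <# K"
      using l_repr_independence[of "t j" "t i" K] ti KH(1) by blast
    then have "b i = b j"
      using t(2) ij by simp
    then show "i = j"
      using b ij by (auto simp: bij_betw_def dest: inj_onD)
  qed (use ti in \<open>simp add: \<theta>_one\<close>)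
  then show ?thesis
    unfolding summand using root by (cases "?\<omega> = 1") (simp_all add: geometric_sum)
qed

section \<open>The subgroups of \<open>G\<close>, indexed by the divisors of its order\<close>

definition torsion :: "nat \<Rightarrow> 'a set"
  where "torsion e = {x \<in> carrier G. \<theta> x ^ e = 1}"

lemma subgroup_torsion: "subgroup (torsion e) G"
  by (rule subgroupI)
    (auto simp: torsion_def \<theta>_mult \<theta>_inv \<theta>_one power_mult_distrib power_inverse)

lemma subgroup_eq_torsion:
  assumes "subgroup H G"
  shows "H = torsion (card H)"
  using mem_subgroup_iff[OF assms] subgroup.subset[OF assms] by (auto simp: torsion_def)

lemma card_torsion:
  assumes "e dvd order G"
  shows "card (torsion e) = e"
proof -
  have "order G > 0"
    using finite_G order_gt_0_iff_finite by blast
  then have "e > 0"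
    using assms by (auto intro: dvd_pos_nat)
  obtain k where k: "order G = e * k" using assms by blast
  have "z \<in> \<theta> ` torsion e" if "z ^ e = 1" for z
  proof -
    have "z ^ order G = 1"
      using that by (simp add: k power_mult)
    then obtain x where "x \<in> carrier G" "z = \<theta> x"
      using \<theta>_image_subgroup[OF subgroup_self] unfolding order_def by blast
    with that show ?thesis by (auto simp: torsion_def)
  qed
  then have "\<theta> ` torsion e = {z. z ^ e = 1}"
    by (auto simp: torsion_def)
  moreover have "card (\<theta> ` torsion e) = card (torsion e)"
    by (intro card_image inj_on_subset[OF inj_\<theta>]) (auto simp: torsion_def)
  ultimately show ?thesis
    using \<open>e > 0\<close> by (simp add: card_complex_roots_unity)
qed

lemma torsion_mono: "d dvd e \<Longrightarrow> torsion d \<subseteq> torsion e"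
  by (auto simp: torsion_def power_mult elim!: dvdE)

lemma card_subgroup_dvd:
  assumes "subgroup K G" "subgroup H G" "K \<subseteq> H"
  shows "card K dvd card H"
  using subgroup_index_mult_card[OF assms] by (metis dvd_triv_right)

text \<open>The intersection is the torsion subgroup of its own order, and that order divides both
  \<open>d\<close> and \<open>e\<close> by Lagrange.\<close>

lemma torsion_Int:
  assumes "d dvd order G" "e dvd order G"
  shows "torsion d \<inter> torsion e = torsion (gcd d e)"
proof
  have sub: "subgroup (torsion d \<inter> torsion e) G"
    by (intro subgroups_Inter_pair subgroup_torsion)
  have "card (torsion d \<inter> torsion e) dvd card (torsion d)"
    "card (torsion d \<inter> torsion e) dvd card (torsion e)"
    using sub subgroup_torsion by (auto intro: card_subgroup_dvd)
  then have "card (torsion d \<inter> torsion e) dvd gcd d e"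
    using assms by (simp add: card_torsion)
  then show "torsion d \<inter> torsion e \<subseteq> torsion (gcd d e)"
    using torsion_mono subgroup_eq_torsion[OF sub] by metis
  show "torsion (gcd d e) \<subseteq> torsion d \<inter> torsion e"
    by (simp add: torsion_mono)
qed

end

section \<open>Universes and transfers\<close>

text \<open>
  A map out of a complex line that is only real linear may be conjugate linear, which costs the
  ambiguity between \<open>\<mu>\<close> and its conjugate. This is where the symmetry of the set of weights enters.
\<close>

lemma real_quadratic_recurrence:
  fixes g :: "complex \<Rightarrow> complex" and \<mu> \<kappa> :: complex
  assumes "norm \<mu> = 1" "norm \<kappa> = 1" "g 1 \<noteq> 0"
    and add: "\<And>w z. g (w + z) = g w + g z" and scale: "\<And>c w. g (c *\<^sub>R w) = c *\<^sub>R g w"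
    and step: "\<And>w. g w = \<kappa> * g (\<mu> * w)"
  shows "\<kappa> = \<mu> \<or> \<kappa> = cnj \<mu>"
proof -
  \<comment> \<open>The quadratic equation of \<open>\<mu>\<close> has real coefficients, so it
    survives the merely real linear \<open>g\<close>. The relation in \<open>step\<close> turns it
    into the same equation for \<open>\<kappa>\<close>, whose roots are \<open>\<mu>\<close> and its
    conjugate.\<close>
  have "\<mu> * \<mu> = (2 * Re \<mu>) *\<^sub>R \<mu> + (-1) *\<^sub>R 1"
    using assms(1) complex_norm_square[of \<mu>] by (simp add: complex_eq_iff algebra_simps power2_eq_square)
  then have "g (\<mu> * \<mu>) = (2 * Re \<mu>) *\<^sub>R g \<mu> + (-1) *\<^sub>R g 1"
    by (simp only: add scale)
  then have "g \<mu> = \<kappa> * ((2 * Re \<mu>) *\<^sub>R g \<mu> - g 1)"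
    using step[of \<mu>] by simp
  then have "\<kappa> * g \<mu> = \<kappa> * (\<kappa> * ((2 * Re \<mu>) *\<^sub>R g \<mu> - g 1))"
    by (rule arg_cong)
  then have "\<kappa> * g \<mu> = \<kappa> * ((2 * Re \<mu>) *\<^sub>R (\<kappa> * g \<mu>) - \<kappa> * g 1)"
    by (simp add: algebra_simps scaleR_conv_of_real)
  moreover have "g 1 = \<kappa> * g \<mu>"
    using step[of 1] by simp
  ultimately have "g 1 * 1 = g 1 * (\<kappa> * (complex_of_real (2 * Re \<mu>) - \<kappa>))"
    by (simp add: algebra_simps scaleR_conv_of_real)
  then have "1 = \<kappa> * (complex_of_real (2 * Re \<mu>) - \<kappa>)"
    using assms(3) mult_left_cancel by blast
  moreover have "complex_of_real (2 * Re \<mu>) = \<mu> + cnj \<mu>" "\<mu> * cnj \<mu> = 1"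
    using assms(1) by (simp_all add: complex_add_cnj complex_norm_square[symmetric])
  ultimately have "(\<kappa> - \<mu>) * (\<kappa> - cnj \<mu>) = 0"
    by (simp add: algebra_simps)
  then show ?thesis by simp
qed

text \<open>By \<open>orth\<close> the matrix \<open>C\<close> is the square root of
  \<open>r\<close> times a unitary one. The inner product of \<open>complex\<close> is the real part
  of the Hermitian form, so the Hermitian identity gives the real one.\<close>

lemma parseval:
  fixes C :: "nat \<Rightarrow> nat \<Rightarrow> complex" and z z' :: "nat \<Rightarrow> complex"
  assumes r: "r > 0"
    and orth: "\<And>i j. i \<in> {1..r} \<Longrightarrow> j \<in> {1..r} \<Longrightarrow>
      (\<Sum>s<r. cnj (C i s) * C j s) = (if i = j then of_nat r else 0)"
  shows "(\<Sum>s<r. inner (complex_of_real (1 / sqrt r) * (\<Sum>i = 1..r. cnj (C i s) * z i))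
      (complex_of_real (1 / sqrt r) * (\<Sum>i = 1..r. cnj (C i s) * z' i))) =
    (\<Sum>i = 1..r. inner (z i) (z' i))"
proof -
  have inner_eq: "inner u v = Re (u * cnj v)" for u v :: complex
    by (simp add: inner_complex_def)
  have q: "complex_of_real (1 / sqrt r) * complex_of_real (1 / sqrt r) = 1 / of_nat r"
  proof -
    have "1 / sqrt r * (1 / sqrt r) = 1 / real r"
      by simp
    then show ?thesis
      by (simp only: of_real_mult[symmetric]) simp
  qed
  have "(\<Sum>s<r. (complex_of_real (1 / sqrt r) * (\<Sum>i = 1..r. cnj (C i s) * z i)) *
      cnj (complex_of_real (1 / sqrt r) * (\<Sum>i = 1..r. cnj (C i s) * z' i))) =
    (\<Sum>s<r. 1 / of_nat r * (\<Sum>i = 1..r. \<Sum>j = 1..r. cnj (C i s) * C j s * (z i * cnj (z' j))))"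
  proof (rule sum.cong[OF refl])
    fix s
    let ?c = "complex_of_real (1 / sqrt r)"
      and ?A = "\<Sum>i = 1..r. cnj (C i s) * z i" and ?B = "\<Sum>i = 1..r. cnj (C i s) * z' i"
    have "?c * ?A * cnj (?c * ?B) = ?c * ?c * (?A * cnj ?B)"
      by (simp only: complex_cnj_mult complex_cnj_complex_of_real mult_ac)
    also have "?A * cnj ?B = (\<Sum>i = 1..r. \<Sum>j = 1..r. cnj (C i s) * C j s * (z i * cnj (z' j)))"
      unfolding cnj_sum sum_product by (intro sum.cong refl) (simp add: mult_ac)
    finally show "?c * ?A * cnj (?c * ?B) = 1 / of_nat r *
        (\<Sum>i = 1..r. \<Sum>j = 1..r. cnj (C i s) * C j s * (z i * cnj (z' j)))"
      unfolding q .
  qed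
  also have "\<dots> = 1 / of_nat r * (\<Sum>s<r. \<Sum>i = 1..r. \<Sum>j = 1..r. cnj (C i s) * C j s * (z i * cnj (z' j)))"
    by (simp add: sum_distrib_left)
  also have "(\<Sum>s<r. \<Sum>i = 1..r. \<Sum>j = 1..r. cnj (C i s) * C j s * (z i * cnj (z' j))) =
      (\<Sum>i = 1..r. \<Sum>s<r. \<Sum>j = 1..r. cnj (C i s) * C j s * (z i * cnj (z' j)))"
    by (rule sum.swap)
  also have "\<dots> = (\<Sum>i = 1..r. \<Sum>j = 1..r. \<Sum>s<r. cnj (C i s) * C j s * (z i * cnj (z' j)))"
    by (rule sum.cong[OF refl], rule sum.swap)
  also have "\<dots> = (\<Sum>i = 1..r. \<Sum>j = 1..r. (if i = j then of_nat r else 0) * (z i * cnj (z' j)))"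
    by (intro sum.cong refl) (simp only: sum_distrib_right[symmetric] orth)
  also have "\<dots> = (\<Sum>i = 1..r. of_nat r * (z i * cnj (z' i)))"
    by (intro sum.cong refl) (simp add: if_distrib[of "\<lambda>x. x * _"] cong: if_cong)
  also have "1 / of_nat r * \<dots> = (\<Sum>i = 1..r. z i * cnj (z' i))"
    using r by (simp add: sum_distrib_left)
  finally show ?thesis
    unfolding inner_eq Re_sum[symmetric] by (rule arg_cong)
qed

section \<open>The universe with prescribed weights, and its transfers\<close>

locale character_sum = faithful_character +
  fixes a0 :: "nat \<Rightarrow> int"
begin

text \<open>
  The first component of \<open>prod_decode m\<close> selects the character and the second one numbers its
  copies, so a shift of the second component is an equivariant isometry. This makes every
  finite-dimensional subrepresentation occur infinitely often without complete reducibility.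
\<close>

definition weight :: "nat \<Rightarrow> int"
  where "weight m = a0 (fst (prod_decode m))"

definition rep :: "'a \<Rightarrow> (nat \<Rightarrow>\<^sub>0 real) \<Rightarrow> (nat \<Rightarrow>\<^sub>0 real)"
  where "rep x v = of_coords (\<lambda>m. \<theta> x powi weight m * coord v m)"

lemma coord_rep [simp]: "coord (rep x v) m = \<theta> x powi weight m * coord v m"
proof -
  have "finite {m. \<theta> x powi weight m * coord v m \<noteq> 0}"
    by (rule finite_subset[OF _ finite_support_coord[of v]]) auto
  then show ?thesis
    unfolding rep_def by (simp add: coord_of_coords)
qed

lemma linear_rep: "linear (rep x)"
  by (rule linearI) (auto intro!: eq_coordI simp: algebra_simps)

lemma rep_mult: "x \<in> carrier G \<Longrightarrow> y \<in> carrier G \<Longrightarrow> rep (x \<otimes> y) v = rep x (rep y v)"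
  by (rule eq_coordI) (simp add: \<theta>_mult power_int_mult_distrib)

lemma rep_one: "rep \<one> v = v"
  by (rule eq_coordI) (simp add: \<theta>_one)

lemma inner_rep: "x \<in> carrier G \<Longrightarrow> inner (rep x u) (rep x v) = inner u v"
  using inner_coord[of "{m. coord u m \<noteq> 0}" "rep x u" "rep x v"]
    inner_coord[of "{m. coord u m \<noteq> 0}" u v]
  by (auto simp: inner_complex_mult_left)

lemma orthogonal_transformation_rep: "x \<in> carrier G \<Longrightarrow> orthogonal_transformation (rep x)"
  by (simp add: orthogonal_transformation_def linear_rep inner_rep)

lemma group_action_rep: "group_action G UNIV rep"
proof -
  have "bij (rep x)" if "x \<in> carrier G" for x
  proof (rule bijI')
    show "rep x u = rep x v \<longleftrightarrow> u = v" for u v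
      using that by (metis inv_closed l_inv rep_mult rep_one)
    show "\<exists>u. v = rep x u" for v
      using that by (metis inv_closed r_inv rep_mult rep_one)
  qed
  then have Bij: "rep x \<in> Bij UNIV" if "x \<in> carrier G" for x
    using that by (simp add: Bij_def)
  have "rep \<in> hom G (BijGroup UNIV)"
    using Bij by (auto simp: hom_def BijGroup_def compose_def rep_mult)
  then show ?thesis
    unfolding group_action_def group_hom_def group_hom_axioms_def
    using group_BijGroup is_group by blast
qed

definition shift :: "nat \<Rightarrow> nat \<Rightarrow> nat"
  where "shift j m = prod_encode (fst (prod_decode m), snd (prod_decode m) + j)"

lemma inj_shift: "inj (shift j)"
  by (rule injI) (metis add_right_cancel prod.collapse prod.inject prod_decode_inverse prod_encode_eq shift_def)

lemma weight_shift [simp]: "weight (shift j m) = weight m"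
  by (simp add: weight_def shift_def)

definition shift_map :: "nat \<Rightarrow> (nat \<Rightarrow>\<^sub>0 real) \<Rightarrow> (nat \<Rightarrow>\<^sub>0 real)"
  where "shift_map j v = of_coords (push UNIV (shift j) (coord v))"

lemma coord_shift_map: "coord (shift_map j v) = push UNIV (shift j) (coord v)"
  unfolding shift_map_def by (rule coord_of_coords_push[OF inj_shift]) simp

lemma linear_shift_map: "linear (shift_map j)"
  by (rule linearI) (auto intro!: eq_coordI simp: coord_shift_map push_def)

lemma inner_shift_map: "inner (shift_map j u) (shift_map j v) = inner u v"
proof -
  let ?F = "{m. coord u m \<noteq> 0} \<union> {m. coord v m \<noteq> 0}"
  have "inner (shift_map j u) (shift_map j v) = (\<Sum>m\<in>?F. inner (coord u m) (coord v m))"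
    unfolding shift_map_def by (rule inner_of_coords_push[OF inj_shift]) auto
  also have "\<dots> = inner u v"
    by (rule inner_coord[symmetric]) auto
  finally show ?thesis .
qed

lemma rep_shift_map: "rep x (shift_map j v) = shift_map j (rep x v)"
proof (rule eq_coordI)
  fix m
  show "coord (rep x (shift_map j v)) m = coord (shift_map j (rep x v)) m"
  proof (cases "m \<in> range (shift j)")
    case True
    then obtain k where "m = shift j k" by blast
    then show ?thesis
      by (simp add: coord_shift_map push_apply inj_shift)
  next
    case False
    then show ?thesis by (simp add: coord_shift_map push_outside)
  qed
qed

lemma finite_dimensional_bounded_support:
  assumes "finite_dimensional V"
  obtains M where "\<And>v m. v \<in> V \<Longrightarrow> snd (prod_decode m) \<ge> M \<Longrightarrow> coord v m = 0"
proof -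
  obtain B where B: "finite B" "span B = V"
    using assms by (auto simp: finite_dimensional_def)
  define S where "S = (\<lambda>m. snd (prod_decode m)) ` (\<Union>v\<in>B. {m. coord v m \<noteq> 0})"
  define M where "M = Suc (Max (insert 0 S))"
  have "finite S"
    using B(1) by (simp add: S_def)
  then have M: "s < M" if "s \<in> S" for s
    using that by (simp add: M_def le_imp_less_Suc)
  have "B \<subseteq> {v. \<forall>m. snd (prod_decode m) \<ge> M \<longrightarrow> coord v m = 0}"
    using M unfolding S_def by (force simp: not_less[symmetric])
  moreover have "subspace {v. \<forall>m. snd (prod_decode m) \<ge> M \<longrightarrow> coord v m = 0}"
    by (auto simp: subspace_def)
  ultimately have "V \<subseteq> {v. \<forall>m. snd (prod_decode m) \<ge> M \<longrightarrow> coord v m = 0}"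
    using B(2) span_minimal by blast
  with that show ?thesis by blast
qed

lemma contains_infinitely_often_rep:
  assumes V: "subrepresentation G rep V" "finite_dimensional V"
  shows "contains_infinitely_often G rep V"
proof -
  obtain M where M: "\<And>v m. v \<in> V \<Longrightarrow> snd (prod_decode m) \<ge> M \<Longrightarrow> coord v m = 0"
    using finite_dimensional_bounded_support[OF V(2)] by blast
  \<comment> \<open>All vectors of \<open>V\<close> live in copies numbered below \<open>M\<close>,
    so shifts by different multiples of \<open>M\<close> occupy disjoint blocks of copies and are
    orthogonal.\<close>
  define W where "W k = shift_map (k * M) ` V" for k
  have "subrepresentation G rep (W k)" for k
    using V(1) unfolding subrepresentation_def W_def
    by (auto simp: rep_shift_map linear_shift_map intro: linear_subspace_image)
  moreover have "isomorphic_subrepresentations G rep V (W k)" for k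
    unfolding isomorphic_subrepresentations_def
    by (rule exI[of _ "shift_map (k * M)"])
      (auto simp: W_def linear_shift_map rep_shift_map norm_eq_sqrt_inner inner_shift_map)
  moreover have "orthogonal x y" if "j \<noteq> k" "x \<in> W j" "y \<in> W k" for j k x y
  proof -
    have supp: "snd (prod_decode m) div M = i" if v: "v \<in> V" "coord (shift_map (i * M) v) m \<noteq> 0" for i v m
    proof -
      obtain m' where m': "m = shift (i * M) m'"
        using v(2) push_outside[of m "shift (i * M)" UNIV] by (force simp: coord_shift_map)
      then have "coord v m' \<noteq> 0"
        using v(2) by (simp add: coord_shift_map push_apply inj_shift)
      then have "snd (prod_decode m') < M"
        using M[OF v(1), of m'] by (simp add: not_le[symmetric]) blast
      then show ?thesis
        by (simp add: m' shift_def)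
    qed
    have "coord x m = 0 \<or> coord y m = 0" for m
      using supp[of _ j m] supp[of _ k m] \<open>j \<noteq> k\<close> \<open>x \<in> W j\<close> \<open>y \<in> W k\<close> unfolding W_def by blast
    then have "inner (coord x m) (coord y m) = 0" for m
      by (metis inner_zero_left inner_zero_right)
    then show ?thesis
      unfolding orthogonal_def using inner_coord[of "{m. coord x m \<noteq> 0}" x y] by simp
  qed
  ultimately show ?thesis
    unfolding contains_infinitely_often_def by blast
qed

lemma G_universe_rep:
  assumes "weight m0 = 0"
  shows "G_universe G rep"
proof -
  let ?e = "\<lambda>i::nat. Poly_Mapping.single i (1::real)"
  have inj: "inj ?e"
    by (rule injI) (metis lookup_single_eq lookup_single_not_eq zero_neq_one)
  have orth: "inner (?e i) (?e j) = (if i = j then 1 else 0)" for i j :: nat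
    using inner_poly_mapping_superset[of "{i}" "?e i" "?e j"]
    by (auto simp: lookup_single when_def)
  have "pairwise orthogonal (range ?e)"
    unfolding pairwise_def
  proof (intro ballI impI)
    fix x y
    assume "x \<in> range ?e" "y \<in> range ?e" "x \<noteq> y"
    then obtain i j where "x = ?e i" "y = ?e j" "i \<noteq> j" by auto
    then show "orthogonal x y"
      by (simp add: orthogonal_def orth)
  qed
  moreover have nz: "?e i \<noteq> 0" for i :: nat
    using orth[of i i] by auto
  ultimately have ind: "independent (range ?e)"
    by (intro pairwise_orthogonal_independent) auto
  have "v \<in> span (range ?e)" for v :: "nat \<Rightarrow>\<^sub>0 real"
  proof -
    have "v = (\<Sum>i\<in>Poly_Mapping.keys v. Poly_Mapping.lookup v i *\<^sub>R ?e i)"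
      by (rule poly_mapping_eqI)
        (auto simp: lookup_sum lookup_scaleR lookup_single when_def in_keys_iff
          if_distrib[of "\<lambda>x. _ * x"] cong: if_cong)
    also have "\<dots> \<in> span (range ?e)"
      by (intro span_sum span_scale span_base) simp
    finally show ?thesis .
  qed
  then have basis: "span (range ?e) = UNIV" by blast
  \<comment> \<open>The real axis of the complex line with index \<open>m0\<close>; weight 0 makes
    the group act trivially there.\<close>
  define V where "V = span {?e (2 * m0)}"
  have fixed: "rep g v = v" if v: "v \<in> V" for g v
  proof (rule eq_coordI)
    fix m
    obtain c where "v = c *\<^sub>R ?e (2 * m0)"
      using v by (auto simp: V_def span_singleton)
    moreover have "2 * m0 = 2 * m + 1 \<longleftrightarrow> False" by presburger
    ultimately have "m = m0" if "coord v m \<noteq> 0"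
      using that by (auto simp: coord_def lookup_single lookup_scaleR when_def complex_eq_iff
          split: if_splits)
    then show "coord (rep g v) m = coord v m"
      using assms by (cases "coord v m = 0") auto
  qed
  have "subrepresentation G rep V"
    using fixed by (simp add: subrepresentation_def V_def)
  moreover have "dim V = 1"
    using dim_eq_card_independent[of "{?e (2 * m0)}"] nz by (simp add: V_def)
  ultimately have "\<exists>V. subrepresentation G rep V \<and> dim V = 1 \<and> (\<forall>g\<in>carrier G. \<forall>v\<in>V. rep g v = v)"
    using fixed by blast
  moreover have "countable (range ?e)" "infinite (range ?e)"
    using inj by (auto simp: finite_image_iff)
  ultimately show ?thesis
    unfolding G_universe_def
    using ind basis group_action_rep orthogonal_transformation_rep contains_infinitely_often_rep
    by blast
qed

text \<open>Tensoring the line of index \<open>m\<close> with one character of \<open>H/K\<close>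
  gives an \<open>H\<close>-line of weight \<open>weight m + card K\<close>. The isometry cannot
  kill it, so some coordinate of U sees it, with that weight or its negative modulo
  \<open>card H\<close>.\<close>

lemma isometries_transfer_imp_weight:
  assumes transfer: "isometries_transfer G rep K H"
    and sym: "\<And>k. \<exists>k'. weight k' = - weight k"
  shows "\<exists>k. int (card H) dvd weight m + int (card K) - weight k"
proof -
  let ?r = "subgroup_index G H K" and ?d = "int (card K)" and ?e = "card H"
  obtain \<sigma> where KH: "subgroup K G" "subgroup H G" "K \<subseteq> H"
    and \<sigma>: "coset_permutation_rep G H K \<sigma>"
    and "isometry_fixed_points G rep ?r (graph_subgroup H \<sigma>) \<noteq> {}"
    using transfer unfolding isometries_transfer_def by blast
  then obtain f where f: "f \<in> linear_isometries ?r"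
    and fix_f: "\<And>h. h \<in> H \<Longrightarrow> isometry_action G rep ?r (h, \<sigma> h) f = f"
    unfolding isometry_fixed_points_def graph_subgroup_def by blast
  note Hc = subgroup.mem_carrier[OF KH(2)]
  obtain b where b: "bij_betw b {1..?r} (left_cosets_in G H K)"
    and b\<sigma>: "\<And>h i. h \<in> H \<Longrightarrow> i \<in> {1..?r} \<Longrightarrow> b (\<sigma> h i) = h <# b i"
    and \<sigma>_hom: "\<sigma> \<in> hom (G\<lparr>carrier := H\<rparr>) (sym_group ?r)"
    using \<sigma> unfolding coset_permutation_rep_def by blast
  have \<sigma>_perm: "\<sigma> h permutes {1..?r}" if "h \<in> H" for h
    using \<sigma>_hom that by (auto simp: hom_def sym_group_def)
  obtain t where t: "\<And>i. i \<in> {1..?r} \<Longrightarrow> t i \<in> H" "\<And>i. i \<in> {1..?r} \<Longrightarrow> b i = t i <# K"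
    using coset_representatives[OF b] by blast
  have r_pos: "?r > 0"
    using subgroup_index_mult_card[OF KH] card_subgroup_pos[OF KH(2)] by (metis gr0I mult_0 less_irrefl)
  define C where "C i = \<theta> (t i) powi (- ?d)" for i
  have C\<sigma>: "C (\<sigma> h i) = \<theta> h powi (- ?d) * C i" if "h \<in> H" "i \<in> {1..?r}" for h i
    unfolding C_def using that b\<sigma> permutes_in_image[OF \<sigma>_perm[OF that(1)], of i]
    by (intro \<theta>_powi_coset_representative[OF KH t, where h = h]) auto
  have norm_C: "norm (C i) = 1" if "i \<in> {1..?r}" for i
    unfolding C_def using t(1)[OF that] Hc by simp
  \<comment> \<open>The twist by \<open>C i\<close> makes these families an \<open>H\<close>-stable
    complex line, on which the inverse of \<open>h\<close> acts as multiplication by the scalar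
    \<open>?\<mu>\<close> introduced below.\<close>
  define x where "x w i = (if i \<in> {1..?r} then of_coords (\<lambda>k. if k = m then w * C i else 0) else 0)"
    for w i
  have coord_x: "coord (x w i) k = (if i \<in> {1..?r} \<and> k = m then w * C i else 0)" for w i k
  proof -
    have "coord (of_coords (\<lambda>k. if k = m then w * C i else 0)) =
        (\<lambda>k. if k = m then w * C i else 0)"
      by (rule coord_of_coords) (auto intro: finite_subset[of _ "{m}"])
    then show ?thesis by (simp add: x_def)
  qed
  have x_in: "x w \<in> direct_power ?r" for w
    by (simp add: x_def direct_power_def del: atLeastAtMost_iff)
  have x_add: "x (w + z) = (\<lambda>i. x w i + x z i)" for w z
    by (rule ext, rule eq_coordI) (simp add: coord_x algebra_simps)
  have x_scale: "x (c *\<^sub>R w) = (\<lambda>i. c *\<^sub>R x w i)" for c w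
    by (rule ext, rule eq_coordI) (simp add: coord_x)
  have f_add: "f (x (w + z)) = f (x w) + f (x z)" for w z
    using f x_in unfolding linear_isometries_def x_add by blast
  have f_scale: "f (x (c *\<^sub>R w)) = c *\<^sub>R f (x w)" for c w
    using f x_in unfolding linear_isometries_def x_scale by blast
  have "inner (f (x 1)) (f (x 1)) = (\<Sum>i = 1..?r. inner (x 1 i) (x 1 i))"
    using f x_in unfolding linear_isometries_def by blast
  also have "\<dots> = (\<Sum>i = 1..?r. 1)"
  proof (rule sum.cong)
    fix i assume i: "i \<in> {1..?r}"
    have "inner (x 1 i) (x 1 i) = inner (C i) (C i)"
      using i by (subst inner_coord[of "{m}"]) (auto simp: coord_x)
    then show "inner (x 1 i) (x 1 i) = 1"
      using norm_C[OF i] by (simp add: norm_eq_1[symmetric] dot_square_norm)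
  qed simp
  finally have "f (x 1) \<noteq> 0"
    using r_pos by auto
  then obtain k where k: "coord (f (x 1)) k \<noteq> 0"
    using coord_inject[of "f (x 1)" 0] by fastforce
  obtain h where h: "h \<in> H" "\<theta> h = cis (2 * pi / real ?e)"
    using subgroup_generator[OF KH(2)] .
  let ?\<mu> = "\<theta> h powi (- weight m - ?d)"
  have shifted: "(\<lambda>i. rep (inv h) (x w (\<sigma> h i))) = x (?\<mu> * w)" for w
  proof (rule ext, rule eq_coordI)
    fix i l
    have "\<sigma> h i \<in> {1..?r} \<longleftrightarrow> i \<in> {1..?r}"
      using permutes_in_image[OF \<sigma>_perm[OF h(1)]] .
    then show "coord (rep (inv h) (x w (\<sigma> h i))) l = coord (x (?\<mu> * w) i) l"
      using h(1) Hc[OF h(1)] C\<sigma>[OF h(1)]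
      by (auto simp: coord_x \<theta>_inv power_int_inverse power_int_minus power_int_diff field_simps)
  qed
  have "f (x w) = rep h (f (x (?\<mu> * w)))" for w
    using fun_cong[OF fix_f[OF h(1)], of "x w"] x_in
    by (simp add: isometry_action_def shifted)
  then have step: "coord (f (x w)) k = \<theta> h powi weight k * coord (f (x (?\<mu> * w))) k" for w
    by (metis coord_rep)
  \<comment> \<open>The first alternative is the conjugate linear case, with \<open>weight k\<close>
    congruent to the negative of the wanted weight; there \<open>sym\<close> supplies another
    index.\<close>
  have "\<theta> h powi weight k = ?\<mu> \<or> \<theta> h powi weight k = cnj ?\<mu>"
    by (rule real_quadratic_recurrence[where g = "\<lambda>w. coord (f (x w)) k", OF _ _ k _ _ step])
      (simp_all add: f_add f_scale Hc h(1))
  moreover have "cnj ?\<mu> = \<theta> h powi (weight m + ?d)"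
  proof -
    have "cnj ?\<mu> = inverse ?\<mu>"
      using inverse_unique[of ?\<mu> "cnj ?\<mu>"] complex_norm_square[of ?\<mu>]
        norm_\<theta>_powi[OF Hc[OF h(1)], of "- weight m - ?d"] by simp
    also have "\<dots> = \<theta> h powi (- (- weight m - ?d))"
      by (rule power_int_minus[symmetric])
    finally show ?thesis by (simp add: add.commute)
  qed
  ultimately have "int ?e dvd (- weight m - ?d) - weight k \<or> int ?e dvd (weight m + ?d) - weight k"
    unfolding h(2) using cis_root_powi_eq_iff[OF card_subgroup_pos[OF KH(2)]] by metis
  then show ?thesis
  proof
    assume dvd: "int ?e dvd (- weight m - ?d) - weight k"
    obtain k' where "weight k' = - weight k" using sym by blast
    moreover have "int ?e dvd - ((- weight m - ?d) - weight k)"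
      using dvd by (simp only: dvd_minus_iff)
    ultimately show ?thesis by (intro exI[of _ k']) (simp add: algebra_simps)
  qed blast
qed

text \<open>Over \<open>H\<close> the representation R[H/K] tensor U is a sum of lines of weights
  \<open>weight m - card K * s\<close>. Each is sent to a line of U whose weight is congruent modulo
  \<open>card H\<close>, hence the same for \<open>H\<close>.\<close>

lemma isometries_transferI:
  assumes KH: "subgroup K G" "subgroup H G" "K \<subseteq> H"
    and weights: "\<And>m s. \<exists>w. int (card H) dvd weight m - int (card K) * int s - a0 w"
  shows "isometries_transfer G rep K H"
proof -
  let ?r = "subgroup_index G H K" and ?d = "int (card K)" and ?e = "int (card H)"
  obtain \<sigma> where \<sigma>: "coset_permutation_rep G H K \<sigma>"
    using exists_coset_permutation_rep[OF KH] .
  note Hc = subgroup.mem_carrier[OF KH(2)]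
  obtain b where b: "bij_betw b {1..?r} (left_cosets_in G H K)"
    and b\<sigma>: "\<And>h i. h \<in> H \<Longrightarrow> i \<in> {1..?r} \<Longrightarrow> b (\<sigma> h i) = h <# b i"
    and \<sigma>_hom: "\<sigma> \<in> hom (G\<lparr>carrier := H\<rparr>) (sym_group ?r)"
    using \<sigma> unfolding coset_permutation_rep_def by blast
  have \<sigma>_perm: "\<sigma> h permutes {1..?r}" if "h \<in> H" for h
    using \<sigma>_hom that by (auto simp: hom_def sym_group_def)
  obtain t where t: "\<And>i. i \<in> {1..?r} \<Longrightarrow> t i \<in> H" "\<And>i. i \<in> {1..?r} \<Longrightarrow> b i = t i <# K"
    using coset_representatives[OF b] by blast
  have r_pos: "?r > 0"
    using subgroup_index_mult_card[OF KH] card_subgroup_pos[OF KH(2)] by (metis gr0I mult_0 less_irrefl)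
  obtain w where w: "\<And>m s. ?e dvd weight m - ?d * int s - a0 (w s m)"
  proof -
    have "\<forall>s m. \<exists>w. ?e dvd weight m - ?d * int s - a0 w"
      using weights by blast
    then have "\<exists>w. \<forall>s m. ?e dvd weight m - ?d * int s - a0 (w s m)"
      by (simp only: choice_iff)
    with that show ?thesis by blast
  qed
  define C where "C i s = \<theta> (t i) powi (?d * int s)" for i s
  define S where "S = {..<?r} \<times> (UNIV :: nat set)"
  \<comment> \<open>The first entry selects the character; using the code of \<open>(s, m)\<close>
    as copy number keeps all target lines distinct.\<close>
  define \<tau> where "\<tau> = (\<lambda>(s, m). prod_encode (w s m, prod_encode (s, m)))"
  have inj_\<tau>: "inj_on \<tau> S"
    by (auto simp: inj_on_def \<tau>_def)
  have weight_\<tau>: "weight (\<tau> (s, m)) = a0 (w s m)" for s m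
    by (simp add: weight_def \<tau>_def)
  \<comment> \<open>The Fourier transform along \<open>H/K\<close> splits the induced representation into characters.\<close>
  define y where "y x = (\<lambda>(s, m). complex_of_real (1 / sqrt ?r) *
    (\<Sum>i = 1..?r. cnj (C i s) * coord (x i) m))" for x
  define f where "f = (\<lambda>x\<in>direct_power ?r. of_coords (push S \<tau> (y x)))"
  let ?M = "\<lambda>x. \<Union>i\<in>{1..?r}. {m. coord (x i) m \<noteq> 0}"
  have supp_y: "{p \<in> S. y x p \<noteq> 0} \<subseteq> {..<?r} \<times> ?M x" for x
  proof (clarsimp simp: S_def)
    fix s m assume "y x (s, m) \<noteq> 0"
    then obtain i where "i \<in> {1..?r}" "cnj (C i s) * coord (x i) m \<noteq> 0"
      unfolding y_def by (auto elim: sum.not_neutral_contains_not_neutral)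
    then show "\<exists>i\<in>{Suc 0..?r}. coord (x i) m \<noteq> 0" by auto
  qed
  have coord_f: "coord (of_coords (push S \<tau> (y x))) = push S \<tau> (y x)" for x
    by (rule coord_of_coords_push[OF inj_\<tau> finite_subset[OF supp_y]]) auto
  have y_add: "y (\<lambda>i. x i + x' i) p = y x p + y x' p" for x x' p
    by (auto simp: y_def algebra_simps sum.distrib split: prod.split)
  have y_scale: "y (\<lambda>i. c *\<^sub>R x i) p = c *\<^sub>R y x p" for x c p
    by (auto simp: y_def algebra_simps sum_distrib_left scaleR_conv_of_real split: prod.split)
  have "inner (f x) (f x') = (\<Sum>i = 1..?r. inner (x i) (x' i))"
    if "x \<in> direct_power ?r" "x' \<in> direct_power ?r" for x x'
  proof -
    let ?F = "?M x \<union> ?M x'"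
    have fin: "finite ?F" by auto
    have "inner (f x) (f x') = (\<Sum>p\<in>{..<?r} \<times> ?F. inner (y x p) (y x' p))"
      unfolding f_def restrict_apply'[OF that(1)] restrict_apply'[OF that(2)]
    proof (rule inner_of_coords_push[OF inj_\<tau>])
      show "finite ({..<?r} \<times> ?F)" using fin by blast
      show "{..<?r} \<times> ?F \<subseteq> S" by (auto simp: S_def)
      show "{p \<in> S. y x p \<noteq> 0} \<subseteq> {..<?r} \<times> ?F" "{p \<in> S. y x' p \<noteq> 0} \<subseteq> {..<?r} \<times> ?F"
        using supp_y[of x] supp_y[of x'] by blast+
    qed
    also have "\<dots> = (\<Sum>s<?r. \<Sum>m\<in>?F. inner (y x (s, m)) (y x' (s, m)))"
      by (simp add: sum.cartesian_product)
    also have "\<dots> = (\<Sum>m\<in>?F. \<Sum>s<?r. inner (y x (s, m)) (y x' (s, m)))"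
      by (rule sum.swap)
    also have "\<dots> = (\<Sum>m\<in>?F. \<Sum>i = 1..?r. inner (coord (x i) m) (coord (x' i) m))"
      unfolding y_def prod.case C_def
      by (intro sum.cong refl parseval r_pos coset_character_orthogonality[OF KH b t])
    also have "\<dots> = (\<Sum>i = 1..?r. \<Sum>m\<in>?F. inner (coord (x i) m) (coord (x' i) m))"
      by (rule sum.swap)
    also have "\<dots> = (\<Sum>i = 1..?r. inner (x i) (x' i))"
      by (intro sum.cong refl inner_coord[symmetric] fin) blast
    finally show ?thesis .
  qed
  moreover have "f (\<lambda>i. x i + x' i) = f x + f x'"
    if "x \<in> direct_power ?r" "x' \<in> direct_power ?r" for x x'
  proof -
    have "(\<lambda>i. x i + x' i) \<in> direct_power ?r"
      using that by (simp add: direct_power_def del: atLeastAtMost_iff)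
    then show ?thesis
      using that by (intro eq_coordI) (simp add: f_def coord_f push_def y_add)
  qed
  moreover have "f (\<lambda>i. c *\<^sub>R x i) = c *\<^sub>R f x" if "x \<in> direct_power ?r" for x c
  proof -
    have "(\<lambda>i. c *\<^sub>R x i) \<in> direct_power ?r"
      using that by (simp add: direct_power_def del: atLeastAtMost_iff)
    then show ?thesis
      using that by (intro eq_coordI) (simp add: f_def coord_f push_def y_scale)
  qed
  moreover have "f \<in> extensional (direct_power ?r)"
    by (simp add: f_def)
  ultimately have "f \<in> linear_isometries ?r"
    unfolding linear_isometries_def by blast
  moreover have "isometry_action G rep ?r (h, \<sigma> h) f = f" if h: "h \<in> H" for h
  proof
    fix x
    show "isometry_action G rep ?r (h, \<sigma> h) f x = f x"
    proof (cases "x \<in> direct_power ?r")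
      case True
      define x' where "x' i = rep (inv h) (x (\<sigma> h i))" for i
      have "rep (inv h) 0 = 0"
        using linear_0[OF linear_rep] .
      moreover have perm_in: "\<sigma> h i \<in> {1..?r} \<longleftrightarrow> i \<in> {1..?r}" for i
        using permutes_in_image[OF \<sigma>_perm[OF h]] .
      ultimately have x': "x' \<in> direct_power ?r"
        using True by (simp add: direct_power_def x'_def del: atLeastAtMost_iff)
      have C\<sigma>: "C (\<sigma> h i) s = \<theta> h powi (?d * int s) * C i s" if "i \<in> {1..?r}" for i s
        unfolding C_def using that b\<sigma> h perm_in
        by (intro \<theta>_powi_coset_representative[OF KH t, where h = h]) auto
      \<comment> \<open>Reindexing the sum by \<open>\<sigma> h\<close> turns the permutation of the
        summands into a scalar; the Fourier component \<open>(s, m)\<close> is an eigenline.\<close>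
      have y': "y x' (s, m) = \<theta> h powi (?d * int s - weight m) * y x (s, m)" for s m
      proof -
        have cnj_\<theta>: "cnj (\<theta> h powi k) * \<theta> h powi k = 1" for k
          using complex_norm_square[of "\<theta> h powi k"] Hc[OF h] by (simp add: mult.commute)
        have "(\<Sum>i = 1..?r. cnj (C i s) * coord (x' i) m) =
          (\<Sum>i = 1..?r. \<theta> h powi (?d * int s - weight m) *
            (cnj (C (\<sigma> h i) s) * coord (x (\<sigma> h i)) m))"
        proof (rule sum.cong[OF refl])
          fix i assume i: "i \<in> {1..?r}"
          have "cnj (C i s) = \<theta> h powi (?d * int s) * cnj (C (\<sigma> h i) s)"
            using cnj_\<theta>[of "?d * int s"] C\<sigma>[OF i, of s] by (simp add: mult_ac)
          then show "cnj (C i s) * coord (x' i) m = \<theta> h powi (?d * int s - weight m) *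
            (cnj (C (\<sigma> h i) s) * coord (x (\<sigma> h i)) m)"
            using Hc[OF h] by (simp add: x'_def \<theta>_inv power_int_inverse power_int_diff field_simps)
        qed
        also have "\<dots> = \<theta> h powi (?d * int s - weight m) *
            (\<Sum>i = 1..?r. cnj (C (\<sigma> h i) s) * coord (x (\<sigma> h i)) m)"
          by (simp add: sum_distrib_left)
        also have "(\<Sum>i = 1..?r. cnj (C (\<sigma> h i) s) * coord (x (\<sigma> h i)) m) =
            (\<Sum>i = 1..?r. cnj (C i s) * coord (x i) m)"
          using sum.permute[OF \<sigma>_perm[OF h], of "\<lambda>i. cnj (C i s) * coord (x i) m"]
          by (simp add: comp_def)
        finally show ?thesis
          by (simp add: y_def mult_ac)
      qed
      have "rep h (f x') = f x"
      proof (rule eq_coordI)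
        fix k
        show "coord (rep h (f x')) k = coord (f x) k"
        proof (cases "k \<in> \<tau> ` S")
          case True': True
          then obtain s m where sm: "(s, m) \<in> S" "k = \<tau> (s, m)" by force
          have "?e dvd (?d * int s - weight m) + a0 (w s m)"
            using w[of m s] dvd_minus_iff[of ?e "weight m - ?d * int s - a0 (w s m)"]
            by (simp add: algebra_simps)
          then have "\<theta> h powi ((?d * int s - weight m) + a0 (w s m)) = 1"
            by (rule \<theta>_powi_subgroup[OF KH(2) h])
          then have "\<theta> h powi a0 (w s m) * (\<theta> h powi (?d * int s - weight m) * y x (s, m)) = y x (s, m)"
            using Hc[OF h] by (simp add: power_int_add mult_ac)
          then show ?thesis
            using True x' by (simp add: f_def coord_f sm push_apply[OF inj_\<tau>] weight_\<tau> y')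
        next
          case False
          then show ?thesis
            using True x' by (simp add: f_def coord_f push_outside)
        qed
      qed
      moreover have "(\<lambda>i. rep (inv h) (x (\<sigma> h i))) = x'"
        by (simp add: x'_def fun_eq_iff)
      ultimately show ?thesis
        using True by (simp add: isometry_action_def)
    next
      case False
      then show ?thesis by (simp add: isometry_action_def f_def)
    qed
  qed
  ultimately have "f \<in> isometry_fixed_points G rep ?r (graph_subgroup H \<sigma>)"
    unfolding isometry_fixed_points_def graph_subgroup_def by blast
  then show ?thesis
    unfolding isometries_transfer_def using KH \<sigma> by blast
qed

lemma isometries_transfer_iff:
  assumes sym: "\<And>x. x \<in> range a0 \<Longrightarrow> - x \<in> range a0"
  shows "isometries_transfer G rep K H \<longleftrightarrow> subgroup K G \<and> subgroup H G \<and> K \<subseteq> H \<and>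
    invariant_mod (range a0) (int (card K)) (int (card H))"
proof (intro iffI conjI)
  have weight_surj: "\<exists>m. weight m = a0 k" for k
    by (rule exI[of _ "prod_encode (k, 0)"]) (simp add: weight_def)
  assume transfer: "isometries_transfer G rep K H"
  then show KH: "subgroup K G" "subgroup H G" "K \<subseteq> H"
    by (auto simp: isometries_transfer_def)
  have "\<exists>k'. weight k' = - weight k" for k
    using sym[of "weight k"] weight_surj by (metis rangeE rangeI weight_def)
  note weights = isometries_transfer_imp_weight[OF transfer this]
  show "invariant_mod (range a0) (int (card K)) (int (card H))"
    unfolding invariant_mod_def
  proof (intro allI impI)
    fix z x assume "x \<in> range a0" and dvd: "int (card H) dvd z - x"
    then obtain m where m: "weight m = x" using weight_surj by blast
    obtain k where "int (card H) dvd weight m + int (card K) - weight k"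
      using weights by blast
    from dvd_add[OF dvd this] have "int (card H) dvd z + int (card K) - weight k"
      by (simp add: m algebra_simps)
    then show "\<exists>y\<in>range a0. int (card H) dvd z + int (card K) - y"
      unfolding weight_def by blast
  qed
next
  assume asm: "subgroup K G \<and> subgroup H G \<and> K \<subseteq> H \<and>
    invariant_mod (range a0) (int (card K)) (int (card H))"
  show "isometries_transfer G rep K H"
  proof (rule isometries_transferI)
    fix m s
    \<comment> \<open>The Fourier index \<open>s\<close> lowers the weight by \<open>s\<close> times
      \<open>card K\<close>, so a negative multiple is called for.\<close>
    have "\<exists>y\<in>range a0. int (card H) dvd weight m + (- int s) * int (card K) - y"
      using asm card_subgroup_pos
      by (intro invariant_mod_mult_int[where x = "weight m"]) (auto simp: weight_def)
    then show "\<exists>w. int (card H) dvd weight m - int (card K) * int s - a0 w"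
      by (auto simp: algebra_simps)
  qed (use asm in auto)
qed

end

text \<open>The discrete logarithm is chosen by \<open>SOME\<close>; the value is independent of the
  choice because the root of unity \<open>\<zeta>\<close> and the generator have the same
  order.\<close>

lemma (in group) cyclic_faithful_character:
  assumes "cyclic_group G" "finite (carrier G)"
  obtains \<theta> where "faithful_character G \<theta>"
proof -
  interpret comm_group G
    using assms(1) by (rule cyclic_imp_abelian_group)
  obtain g where g: "g \<in> carrier G" "carrier G = range (\<lambda>k::int. g [^] k)"
    using assms(1) by (auto simp: cyclic_group)
  have ord: "ord g = order G"
    using generate_pow[OF g(1)] generate_pow_card[OF g(1)] g(2)
    by (simp add: order_def image_def)
  have order: "order G > 0"
    using assms(2) order_gt_0_iff_finite by blast
  define \<zeta> where "\<zeta> = cis (2 * pi / real (order G))"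
  define \<theta> where "\<theta> x = \<zeta> powi (SOME k. g [^] (k::int) = x)" for x
  have \<theta>_pow: "\<theta> (g [^] k) = \<zeta> powi k" for k :: int
  proof -
    have "g [^] (SOME j. g [^] (j::int) = g [^] k) = g [^] k"
      by (rule someI) (rule refl)
    then show ?thesis
      unfolding \<theta>_def \<zeta>_def
      by (simp add: cis_root_powi_eq_iff[OF order] int_pow_eq[OF g(1)] ord dvd_diff_commute)
  qed
  have "faithful_character G \<theta>"
  proof
    show "finite (carrier G)" by fact
    show "\<theta> \<one> = 1"
      using \<theta>_pow[of 0] by simp
    show "\<theta> (x \<otimes> y) = \<theta> x * \<theta> y" if xy: "x \<in> carrier G" "y \<in> carrier G" for x y
    proof -
      obtain i j :: int where "x = g [^] i" "y = g [^] j"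
        using xy unfolding g(2) by blast
      moreover have "\<zeta> \<noteq> 0" by (simp add: \<zeta>_def)
      ultimately show ?thesis
        by (simp add: int_pow_mult[OF g(1), symmetric] \<theta>_pow power_int_add)
    qed
    show "inj_on \<theta> (carrier G)"
    proof (rule inj_onI)
      fix x y assume "x \<in> carrier G" "y \<in> carrier G" and eq: "\<theta> x = \<theta> y"
      then obtain i j :: int where ij: "x = g [^] i" "y = g [^] j"
        unfolding g(2) by blast
      then have "int (order G) dvd i - j"
        using eq unfolding ij \<theta>_pow \<zeta>_def by (simp add: cis_root_powi_eq_iff[OF order])
      then show "x = y"
        unfolding ij by (simp add: int_pow_eq[OF g(1)] ord dvd_diff_commute)
    qed
  qed
  with that show ?thesis by blast
qed

theorem theorem1p2:
  fixes G :: "('a, 'b) monoid_scheme"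
    and R :: "'a set \<Rightarrow> 'a set \<Rightarrow> bool"
    and n p q :: nat
  assumes "Factorial_Ring.prime p" and "Factorial_Ring.prime q" and "p \<noteq> q"
    and "p > 3" and "q > 3"
    and "group G" and "cyclic_group G" and "order G = p * q ^ n"
    and "saturated_transfer_system G R"
  shows "linear_isometric G R"
proof -
  interpret group G by fact
  interpret R: saturated_transfer_system G R by fact
  obtain \<theta> where "faithful_character G \<theta>"
    using cyclic_faithful_character assms(7) R.finite_carrier by blast
  then interpret faithful_character G \<theta> .
  \<comment> \<open>The divisibility clauses matter: for \<open>e\<close> not dividing the order,
    \<open>torsion e\<close> is still a subgroup, but not one of order \<open>e\<close>.\<close>
  define D where "D d e \<longleftrightarrow> d dvd order G \<and> e dvd order G \<and> R (torsion d) (torsion e)" for d e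
  obtain X :: "int set" where X: "0 \<in> X" "\<And>x. x \<in> X \<Longrightarrow> - x \<in> X"
    and D_iff: "\<And>d e. d dvd e \<Longrightarrow> e dvd p * q ^ n \<Longrightarrow> D d e \<longleftrightarrow> invariant_mod X (int d) (int e)"
  proof (rule saturated_divisor_relation_realizable[of p q D n])
    show "D d e \<Longrightarrow> e dvd p * q ^ n" for d e
      by (simp add: D_def assms(8))
    show "D d d" if "d dvd p * q ^ n" for d
      using that R.reflexive[OF subgroup_torsion] by (simp add: D_def assms(8))
    show "D d e \<longleftrightarrow> D d f \<and> D f e" if dvd: "d dvd f" "f dvd e" "e dvd p * q ^ n" for d e f
    proof -
      have sub: "torsion d \<subseteq> torsion f" "torsion f \<subseteq> torsion e"
        using dvd torsion_mono by blast+
      have dvd_order: "d dvd order G" "f dvd order G" "e dvd order G"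
        using dvd unfolding assms(8) by (meson dvd_trans)+
      \<comment> \<open>Restriction to the middle subgroup gives the lower half of the chain; two
        out of three then gives the upper half.\<close>
      have "R (torsion d) (torsion f)" if "R (torsion d) (torsion e)"
        using R.restriction[OF that subgroup_torsion sub(2)] sub(1) by (simp add: inf_absorb1)
      then show ?thesis
        using R.two_out_of_three[OF subgroup_torsion subgroup_torsion subgroup_torsion sub] dvd_order
        unfolding D_def by blast
    qed
    show "D (gcd d m) m" if "D d e" "m dvd e" for d e m
    proof -
      have dvd: "d dvd order G" "m dvd order G"
        using that unfolding D_def by (meson dvd_trans)+
      have "R (torsion d \<inter> torsion m) (torsion m)"
        using that by (intro R.restriction[OF _ subgroup_torsion torsion_mono]) (auto simp: D_def)
      then show ?thesis
        using dvd by (auto simp: D_def torsion_Int intro: dvd_trans[OF gcd_dvd1])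
    qed
  qed (use assms in auto)
  \<comment> \<open>For a finite set \<open>X\<close> the enumeration repeats values, which is
    harmless because every weight is repeated infinitely often anyway.\<close>
  define a0 where "a0 = from_nat_into X"
  have range: "range a0 = X"
    using X(1) unfolding a0_def by (intro range_from_nat_into) auto
  interpret character_sum G \<theta> a0 ..
  have "R K H \<longleftrightarrow> isometries_transfer G rep K H" for K H
  proof -
    have "R K H \<longleftrightarrow> invariant_mod X (int (card K)) (int (card H))"
      if KH: "subgroup K G" "subgroup H G" "K \<subseteq> H"
    proof -
      have "card K dvd card H" "card H dvd p * q ^ n"
        using card_subgroup_dvd[OF KH] card_subgroup_dvd[OF KH(2) subgroup_self]
          subgroup.subset[OF KH(2)] by (simp_all add: assms(8)[unfolded order_def])
      then have "D (card K) (card H) \<longleftrightarrow> invariant_mod X (int (card K)) (int (card H))"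
        "card K dvd order G" "card H dvd order G"
        using D_iff unfolding assms(8) by (blast intro: dvd_trans)+
      then show ?thesis
        unfolding D_def using subgroup_eq_torsion KH by metis
    qed
    moreover have "subgroup K G \<and> subgroup H G \<and> K \<subseteq> H" if "R K H"
      using that R.subgroups R.refines_inclusion by blast
    ultimately show ?thesis
      using isometries_transfer_iff[of K H] X(2) unfolding range by blast
  qed
  then have "R = isometries_transfer G rep"
    by blast
  moreover obtain k where "a0 k = 0"
    using X(1) range by (metis rangeE)
  then have "weight (prod_encode (k, 0)) = 0"
    by (simp add: weight_def)
  then have "G_universe G rep"
    by (rule G_universe_rep)
  ultimately show ?thesis
    unfolding linear_isometric_def using R.transfer_system_axioms by blast
qed

end
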